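(* Let $G$ be a finite non-abelian group generated by two elements $a,b\in G$ satisfying $a^2=b^2$. Let $A=\Bbbk\langle u,v\rangle/\langle u^2-v^2\rangle$, equipped with the $G$-grading determined by $\deg_G u=a$ and $\deg_G v=b$, and let $H=(\Bbbk G)^*$ act on $A$ accordingly. Then the Auslander map $$\gamma: A\# H\to \operatorname{End}(A_{A^H}),\qquad \gamma(x\# h)(y)=x(h\cdot y),$$ is an isomorphism if and only if $|ab|=\tfrac12|G|$, where $|ab|$ denotes the order of $ab$ in $G$.
   Context: $\Bbbk$ is an algebraically closed field of characteristic $0$. The Hopf algebra $H=(\Bbbk G)^*$ is the dual of the group algebra, with basis of orthogonal idempotents $\{\phi_g\mid g\in G\}$ dual to $G$, coproduct $\Delta(\phi_g)=\sum_{xy=g}\phi_x\otimes\phi_y$ and counit $\varepsilon(\phi_g)=1$ if $g=1_G$ and $0$ otherwise. A $G$-grading $A=\bigoplus_{g\in G}A_g$ (with $A_gA_h\subseteq A_{gh}$) makes $A$ an $H$-module algebra via $\phi_g\cdot x=x_g$, the component of $x$ in $A_g$. The invariant ring is $A^H=\{x\in A\mid h\cdot x=\varepsilon(h)x \text{ for all } h\in H\}=A_{1_G}$. The smash product $A\# H$ is $A\otimes_\Bbbk H$ as a vector space, with multiplication $(x\# h)(y\# k)=\sum x(h_1\cdot y)\# h_2k$, where $\Delta(h)=\sum h_1\otimes h_2$. $\operatorname{End}(A_{A^H})$ is the ring of endomorphisms of $A$ as a right $A^H$-module. *)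

theory Defs
  imports
    "HOL-Algebra.Algebra"
    "HOL-Library.Poly_Mapping"
    "HOL-Computational_Algebra.Polynomial"
begin

section \<open>Free algebras\<close>

text \<open>
  Words form a monoid under concatenation.  It is written additively so that the convolution product
  of \<^theory>\<open>HOL-Library.Poly_Mapping\<close> makes the finitely supported functions on words into
  the free associative algebra.
\<close>

datatype 'x free_word = Word (letters: "'x list")

instantiation free_word :: (type) monoid_add
begin
definition zero_free_word :: "'a free_word" where "0 = Word []"
definition plus_free_word :: "'a free_word \<Rightarrow> 'a free_word \<Rightarrow> 'a free_word"
  where "v + w = Word (letters v @ letters w)"
instance by standard (simp_all add: zero_free_word_def plus_free_word_def)
end

type_synonym ('x, 'k) free_alg_elem = "'x free_word \<Rightarrow>\<^sub>0 'k"

definition free_algebra :: "('k::field, ('x, 'k) free_alg_elem) module" where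
  "free_algebra = \<lparr>carrier = UNIV, monoid.mult = (*), one = 1, ring.zero = 0, add = (+),
                   module.smult = (\<lambda>c p. Poly_Mapping.single 0 c * p)\<rparr>"

definition free_gen :: "'x \<Rightarrow> ('x, 'k::field) free_alg_elem" where
  "free_gen x = Poly_Mapping.single (Word [x]) 1"

text \<open>A quotient of an algebra by a two-sided ideal, with the induced scalar multiplication.\<close>

definition quotient_algebra :: "('k, 'c) module \<Rightarrow> 'c set \<Rightarrow> ('k, 'c set) module" where
  "quotient_algebra R I = ring.extend (R Quot I)
     (module.fields (\<lambda>c x. (I +>\<^bsub>R\<^esub> (c \<odot>\<^bsub>R\<^esub> \<one>\<^bsub>R\<^esub>)) \<otimes>\<^bsub>R Quot I\<^esub> x))"


section \<open>The Hopf algebra dual to the group algebra\<close>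

text \<open>
  Linear functionals on the group algebra of \<open>G\<close> are identified with their values on the
  basis \<open>G\<close>, so the product is pointwise.
\<close>

definition group_dual :: "('g, 'm) monoid_scheme \<Rightarrow> ('k::field, 'g \<Rightarrow> 'k) module" where
  "group_dual G = \<lparr>carrier = carrier G \<rightarrow>\<^sub>E UNIV,
     monoid.mult = (\<lambda>h k. \<lambda>x\<in>carrier G. h x * k x), one = (\<lambda>x\<in>carrier G. 1),
     ring.zero = (\<lambda>x\<in>carrier G. 0), add = (\<lambda>h k. \<lambda>x\<in>carrier G. h x + k x),
     module.smult = (\<lambda>c h. \<lambda>x\<in>carrier G. c * h x)\<rparr>"

definition dual_idem :: "('g, 'm) monoid_scheme \<Rightarrow> 'g \<Rightarrow> 'g \<Rightarrow> 'k::field" where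
  "dual_idem G g = (\<lambda>x\<in>carrier G. if x = g then 1 else 0)"

definition dual_counit :: "('g, 'm) monoid_scheme \<Rightarrow> ('g \<Rightarrow> 'k::field) \<Rightarrow> 'k" where
  "dual_counit G h = h \<one>\<^bsub>G\<^esub>"

text \<open>
  The coproduct, given by its coordinates: \<open>dual_comult G h s t\<close> is the coefficient of
  \<open>\<phi>\<^sub>s \<otimes> \<phi>\<^sub>t\<close> in \<open>\<Delta>(h)\<close>; for \<open>h = \<phi>\<^sub>g\<close>
  it is \<open>1\<close> if \<open>s t = g\<close> and \<open>0\<close> otherwise.
\<close>

definition dual_comult :: "('g, 'm) monoid_scheme \<Rightarrow> ('g \<Rightarrow> 'k::field) \<Rightarrow> 'g \<Rightarrow> 'g \<Rightarrow> 'k" where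
  "dual_comult G h s t = h (s \<otimes>\<^bsub>G\<^esub> t)"


section \<open>Graded algebras and the action of the dual group algebra\<close>

locale graded_algebra = G: group G + A: ring A
  for G :: "('g, 'm) monoid_scheme" (structure)
    and A :: "('k::field, 'c) module" (structure)
    and gr :: "'g \<Rightarrow> 'c set" +
  assumes finite_G: "finite (carrier G)"
    and smult_closed: "x \<in> carrier A \<Longrightarrow> c \<odot>\<^bsub>A\<^esub> x \<in> carrier A"
    and smult_l_distr: "x \<in> carrier A \<Longrightarrow> (c + d) \<odot>\<^bsub>A\<^esub> x = c \<odot>\<^bsub>A\<^esub> x \<oplus>\<^bsub>A\<^esub> d \<odot>\<^bsub>A\<^esub> x"
    and smult_r_distr: "x \<in> carrier A \<Longrightarrow> y \<in> carrier A \<Longrightarrow>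
          c \<odot>\<^bsub>A\<^esub> (x \<oplus>\<^bsub>A\<^esub> y) = c \<odot>\<^bsub>A\<^esub> x \<oplus>\<^bsub>A\<^esub> c \<odot>\<^bsub>A\<^esub> y"
    and smult_assoc1: "x \<in> carrier A \<Longrightarrow> (c * d) \<odot>\<^bsub>A\<^esub> x = c \<odot>\<^bsub>A\<^esub> (d \<odot>\<^bsub>A\<^esub> x)"
    and smult_one: "x \<in> carrier A \<Longrightarrow> 1 \<odot>\<^bsub>A\<^esub> x = x"
    and smult_mult_left: "x \<in> carrier A \<Longrightarrow> y \<in> carrier A \<Longrightarrow>
          (c \<odot>\<^bsub>A\<^esub> x) \<otimes>\<^bsub>A\<^esub> y = c \<odot>\<^bsub>A\<^esub> (x \<otimes>\<^bsub>A\<^esub> y)"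
    and smult_mult_right: "x \<in> carrier A \<Longrightarrow> y \<in> carrier A \<Longrightarrow>
          x \<otimes>\<^bsub>A\<^esub> (c \<odot>\<^bsub>A\<^esub> y) = c \<odot>\<^bsub>A\<^esub> (x \<otimes>\<^bsub>A\<^esub> y)"
    and gr_subgroup: "g \<in> carrier G \<Longrightarrow> additive_subgroup (gr g) A"
    and gr_smult: "g \<in> carrier G \<Longrightarrow> x \<in> gr g \<Longrightarrow> c \<odot>\<^bsub>A\<^esub> x \<in> gr g"
    and gr_mult: "g \<in> carrier G \<Longrightarrow> h \<in> carrier G \<Longrightarrow> x \<in> gr g \<Longrightarrow> y \<in> gr h \<Longrightarrow>
          x \<otimes>\<^bsub>A\<^esub> y \<in> gr (g \<otimes>\<^bsub>G\<^esub> h)"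
    and gr_direct: "x \<in> carrier A \<Longrightarrow>
          \<exists>!f. f \<in> (\<Pi>\<^sub>E g\<in>carrier G. gr g) \<and> x = (\<Oplus>\<^bsub>A\<^esub>g\<in>carrier G. f g)"

definition hom_component ::
  "('g, 'm) monoid_scheme \<Rightarrow> ('k, 'c) module \<Rightarrow> ('g \<Rightarrow> 'c set) \<Rightarrow> 'g \<Rightarrow> 'c \<Rightarrow> 'c" where
  "hom_component G A gr g x =
     (THE f. f \<in> (\<Pi>\<^sub>E g\<in>carrier G. gr g) \<and> x = (\<Oplus>\<^bsub>A\<^esub>g\<in>carrier G. f g)) g"

text \<open>The linear extension of \<open>\<phi>\<^sub>g \<cdot> x = x\<^sub>g\<close>.\<close>

definition dual_action ::
  "('g, 'm) monoid_scheme \<Rightarrow> ('k::field, 'c) module \<Rightarrow> ('g \<Rightarrow> 'c set) \<Rightarrow> ('g \<Rightarrow> 'k) \<Rightarrow> 'c \<Rightarrow> 'c" where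
  "dual_action G A gr h x = (\<Oplus>\<^bsub>A\<^esub>g\<in>carrier G. h g \<odot>\<^bsub>A\<^esub> hom_component G A gr g x)"

definition inv_ring ::
  "('g, 'm) monoid_scheme \<Rightarrow> ('k::field, 'c) module \<Rightarrow> ('g \<Rightarrow> 'c set) \<Rightarrow> 'c set" where
  "inv_ring G A gr = {x \<in> carrier A. \<forall>h \<in> carrier (group_dual G :: ('k, 'g \<Rightarrow> 'k) module).
     dual_action G A gr h x = dual_counit G h \<odot>\<^bsub>A\<^esub> x}"


section \<open>Smash product, endomorphism ring and Auslander map\<close>

text \<open>
  Since \<open>(\<phi>\<^sub>g)\<close> is a finite basis of \<open>H\<close>, every element of
  \<open>A \<otimes> H\<close> is uniquely of the form \<open>\<Sum>g. F g \<otimes> \<phi>\<^sub>g\<close>; it is represented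
  by the function \<open>F\<close> from \<open>G\<close> to \<open>A\<close>.
\<close>

definition smash_tensor ::
  "('g, 'm) monoid_scheme \<Rightarrow> ('k::field, 'c) module \<Rightarrow> 'c \<Rightarrow> ('g \<Rightarrow> 'k) \<Rightarrow> ('g \<Rightarrow> 'c)" where
  "smash_tensor G A x h = (\<lambda>g\<in>carrier G. h g \<odot>\<^bsub>A\<^esub> x)"

text \<open>
  The product of \<open>x # \<phi>\<^sub>g\<close> and \<open>y # \<phi>\<^sub>h\<close> is
  \<open>\<Sum>s t. \<Delta>(\<phi>\<^sub>g)(s,t) x (\<phi>\<^sub>s \<cdot> y) # \<phi>\<^sub>t \<phi>\<^sub>h\<close>; the definition is
  the biadditive extension of this, evaluated at the coordinate \<open>r\<close>.  The Sweedler form for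
  arbitrary elements of \<open>H\<close> is the lemma \<open>smash_tensor_mult\<close> below.
\<close>

definition smash_mult ::
  "('g, 'm) monoid_scheme \<Rightarrow> ('k::field, 'c) module \<Rightarrow> ('g \<Rightarrow> 'c set)
     \<Rightarrow> ('g \<Rightarrow> 'c) \<Rightarrow> ('g \<Rightarrow> 'c) \<Rightarrow> ('g \<Rightarrow> 'c)" where
  "smash_mult G A gr F F' = (\<lambda>r\<in>carrier G.
     \<Oplus>\<^bsub>A\<^esub>g\<in>carrier G. \<Oplus>\<^bsub>A\<^esub>h\<in>carrier G. \<Oplus>\<^bsub>A\<^esub>s\<in>carrier G. \<Oplus>\<^bsub>A\<^esub>t\<in>carrier G.
       smash_tensor G A
         (dual_comult G (dual_idem G g) s t \<odot>\<^bsub>A\<^esub> (F g \<otimes>\<^bsub>A\<^esub> dual_action G A gr (dual_idem G s) (F' h)))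
         (dual_idem G t \<otimes>\<^bsub>group_dual G\<^esub> dual_idem G h) r)"

definition smash_product ::
  "('g, 'm) monoid_scheme \<Rightarrow> ('k::field, 'c) module \<Rightarrow> ('g \<Rightarrow> 'c set) \<Rightarrow> ('k, 'g \<Rightarrow> 'c) module" where
  "smash_product G A gr = \<lparr>carrier = carrier G \<rightarrow>\<^sub>E carrier A,
     monoid.mult = smash_mult G A gr, one = smash_tensor G A \<one>\<^bsub>A\<^esub> \<one>\<^bsub>group_dual G\<^esub>,
     ring.zero = (\<lambda>g\<in>carrier G. \<zero>\<^bsub>A\<^esub>), add = (\<lambda>F F'. \<lambda>g\<in>carrier G. F g \<oplus>\<^bsub>A\<^esub> F' g),
     module.smult = (\<lambda>c F. \<lambda>g\<in>carrier G. c \<odot>\<^bsub>A\<^esub> F g)\<rparr>"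

text \<open>
  \<open>right_End A B\<close> is the ring of endomorphisms of \<open>A\<close> as a right module over the
  subring \<open>B\<close> of \<open>A\<close>.
\<close>

definition right_End :: "('k, 'c) module \<Rightarrow> 'c set \<Rightarrow> ('c \<Rightarrow> 'c) ring" where
  "right_End A B = \<lparr>carrier = {f \<in> carrier A \<rightarrow>\<^sub>E carrier A.
       (\<forall>x\<in>carrier A. \<forall>y\<in>carrier A. f (x \<oplus>\<^bsub>A\<^esub> y) = f x \<oplus>\<^bsub>A\<^esub> f y) \<and>
       (\<forall>x\<in>carrier A. \<forall>r\<in>B. f (x \<otimes>\<^bsub>A\<^esub> r) = f x \<otimes>\<^bsub>A\<^esub> r)},
     monoid.mult = (\<lambda>f g. compose (carrier A) f g), one = (\<lambda>x\<in>carrier A. x),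
     ring.zero = (\<lambda>x\<in>carrier A. \<zero>\<^bsub>A\<^esub>), add = (\<lambda>f g. \<lambda>x\<in>carrier A. f x \<oplus>\<^bsub>A\<^esub> g x)\<rparr>"

definition auslander_map ::
  "('g, 'm) monoid_scheme \<Rightarrow> ('k::field, 'c) module \<Rightarrow> ('g \<Rightarrow> 'c set) \<Rightarrow> ('g \<Rightarrow> 'c) \<Rightarrow> ('c \<Rightarrow> 'c)" where
  "auslander_map G A gr F = (\<lambda>y\<in>carrier A.
     \<Oplus>\<^bsub>A\<^esub>g\<in>carrier G. F g \<otimes>\<^bsub>A\<^esub> dual_action G A gr (dual_idem G g) y)"


context graded_algebra
begin

lemma gr_carrier: "g \<in> carrier G \<Longrightarrow> x \<in> gr g \<Longrightarrow> x \<in> carrier A"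
  by (meson additive_subgroup.a_Hcarr gr_subgroup)

lemma hom_component_mem:
  assumes "g \<in> carrier G" "x \<in> carrier A"
  shows "hom_component G A gr g x \<in> gr g"
  using theI'[OF gr_direct[OF assms(2)]] assms(1) unfolding hom_component_def by auto

lemma hom_component_closed:
  "g \<in> carrier G \<Longrightarrow> x \<in> carrier A \<Longrightarrow> hom_component G A gr g x \<in> carrier A"
  using hom_component_mem gr_carrier by blast

lemma hom_component_sum:
  assumes "x \<in> carrier A"
  shows "x = (\<Oplus>\<^bsub>A\<^esub>g\<in>carrier G. hom_component G A gr g x)"
  using theI'[OF gr_direct[OF assms]] unfolding hom_component_def by auto

lemma hom_component_unique:
  assumes "\<And>g. g \<in> carrier G \<Longrightarrow> f g \<in> gr g" "x = (\<Oplus>\<^bsub>A\<^esub>g\<in>carrier G. f g)" "g \<in> carrier G"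
  shows "hom_component G A gr g x = f g"
proof -
  let ?f = "restrict f (carrier G)"
  have x: "x \<in> carrier A"
    using assms(1,2) gr_carrier by (auto intro!: A.finsum_closed)
  have f: "?f \<in> (\<Pi>\<^sub>E g\<in>carrier G. gr g)" using assms(1) by auto
  have s: "x = (\<Oplus>\<^bsub>A\<^esub>g\<in>carrier G. ?f g)"
    unfolding assms(2) using assms(1) gr_carrier by (intro A.finsum_cong') auto
  have "(THE f. f \<in> (\<Pi>\<^sub>E g\<in>carrier G. gr g) \<and> x = (\<Oplus>\<^bsub>A\<^esub>g\<in>carrier G. f g)) = ?f"
    by (rule the1_equality[OF gr_direct[OF x]]) (use f s in blast)
  then show ?thesis using assms(3) by (simp add: hom_component_def)
qed

lemma smult_zero [simp]: "x \<in> carrier A \<Longrightarrow> 0 \<odot>\<^bsub>A\<^esub> x = \<zero>\<^bsub>A\<^esub>"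
  using smult_l_distr[of x 0 0] smult_closed[of x 0] A.add.r_cancel_one by force

lemma smult_zero_right [simp]: "c \<odot>\<^bsub>A\<^esub> \<zero>\<^bsub>A\<^esub> = \<zero>\<^bsub>A\<^esub>"
  using smult_assoc1[of "\<zero>\<^bsub>A\<^esub>" c 0] by simp

lemma smult_finsum:
  assumes "finite S" "\<And>i. i \<in> S \<Longrightarrow> f i \<in> carrier A"
  shows "c \<odot>\<^bsub>A\<^esub> (\<Oplus>\<^bsub>A\<^esub>i\<in>S. f i) = (\<Oplus>\<^bsub>A\<^esub>i\<in>S. c \<odot>\<^bsub>A\<^esub> f i)"
  using assms by (induction S rule: finite_induct) (simp_all add: Pi_def smult_closed smult_r_distr)

lemma hom_component_smult:
  assumes "g \<in> carrier G" "x \<in> carrier A"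
  shows "hom_component G A gr g (c \<odot>\<^bsub>A\<^esub> x) = c \<odot>\<^bsub>A\<^esub> hom_component G A gr g x"
proof (rule hom_component_unique)
  show "c \<odot>\<^bsub>A\<^esub> x = (\<Oplus>\<^bsub>A\<^esub>g\<in>carrier G. c \<odot>\<^bsub>A\<^esub> hom_component G A gr g x)"
    using smult_finsum[OF finite_G, of "\<lambda>g. hom_component G A gr g x" c]
      hom_component_sum[OF assms(2)] assms hom_component_closed
    by simp
qed (use assms gr_smult hom_component_mem in auto)

lemma finsum_single:
  assumes "r \<in> carrier G" "\<And>t. t \<in> carrier G \<Longrightarrow> f t \<in> carrier A"
    "\<And>t. t \<in> carrier G \<Longrightarrow> t \<noteq> r \<Longrightarrow> f t = \<zero>\<^bsub>A\<^esub>"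
  shows "(\<Oplus>\<^bsub>A\<^esub>t\<in>carrier G. f t) = f r"
proof -
  have "(\<Oplus>\<^bsub>A\<^esub>t\<in>carrier G. f t) = (\<Oplus>\<^bsub>A\<^esub>t\<in>carrier G. if r = t then f t else \<zero>\<^bsub>A\<^esub>)"
    using assms by (intro A.finsum_cong') auto
  also have "\<dots> = f r"
    using assms finite_G by (intro A.finsum_singleton) auto
  finally show ?thesis .
qed

lemma dual_action_idem:
  assumes "g \<in> carrier G" "x \<in> carrier A"
  shows "dual_action G A gr (dual_idem G g) x = hom_component G A gr g x"
  unfolding dual_action_def using assms
  by (subst finsum_single[of g])
    (auto simp: dual_idem_def smult_one hom_component_closed)

lemma dual_action_closed: "x \<in> carrier A \<Longrightarrow> dual_action G A gr h x \<in> carrier A"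
  unfolding dual_action_def
  by (intro A.finsum_closed) (auto intro!: smult_closed hom_component_closed)

lemma smash_mult_eq:
  assumes F: "\<And>g. g \<in> carrier G \<Longrightarrow> F g \<in> carrier A"
    and F': "\<And>g. g \<in> carrier G \<Longrightarrow> F' g \<in> carrier A" and r: "r \<in> carrier G"
  shows "smash_mult G A gr F F' r =
    (\<Oplus>\<^bsub>A\<^esub>s\<in>carrier G. F (s \<otimes>\<^bsub>G\<^esub> r) \<otimes>\<^bsub>A\<^esub> hom_component G A gr s (F' r))"
proof -
  note cl = hom_component_closed dual_action_closed smult_closed F F' r
  let ?T = "\<lambda>g h s t. smash_tensor G A
         (dual_comult G (dual_idem G g) s t \<odot>\<^bsub>A\<^esub> (F g \<otimes>\<^bsub>A\<^esub> dual_action G A gr (dual_idem G s) (F' h)))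
         (dual_idem G t \<otimes>\<^bsub>group_dual G\<^esub> dual_idem G h) r"
  let ?Y = "\<lambda>g h s. F g \<otimes>\<^bsub>A\<^esub> hom_component G A gr s (F' h)"
  have T: "?T g h s t = (if t = r \<and> h = r \<and> g = s \<otimes>\<^bsub>G\<^esub> r then ?Y g h s else \<zero>\<^bsub>A\<^esub>)"
    if "g \<in> carrier G" "h \<in> carrier G" "s \<in> carrier G" "t \<in> carrier G" for g h s t
    using that cl
    by (auto simp: smash_tensor_def group_dual_def dual_idem_def[of G t] dual_idem_def[of G h]
        dual_idem_def[of G g] dual_comult_def dual_action_idem smult_one)
  have Ycl: "?Y g h s \<in> carrier A" if "g \<in> carrier G" "h \<in> carrier G" "s \<in> carrier G" for g h s
    using that cl by auto
  have t: "(\<Oplus>\<^bsub>A\<^esub>t\<in>carrier G. ?T g h s t) = (if h = r \<and> g = s \<otimes>\<^bsub>G\<^esub> r then ?Y g h s else \<zero>\<^bsub>A\<^esub>)"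
    if "g \<in> carrier G" "h \<in> carrier G" "s \<in> carrier G" for g h s
    using that Ycl by (subst finsum_single[OF r]) (auto simp: T r)
  have h: "(\<Oplus>\<^bsub>A\<^esub>h\<in>carrier G. \<Oplus>\<^bsub>A\<^esub>s\<in>carrier G. \<Oplus>\<^bsub>A\<^esub>t\<in>carrier G. ?T g h s t)
      = ?Y g r (g \<otimes>\<^bsub>G\<^esub> inv\<^bsub>G\<^esub> r)" if g: "g \<in> carrier G" for g
  proof -
    have "(\<Oplus>\<^bsub>A\<^esub>h\<in>carrier G. \<Oplus>\<^bsub>A\<^esub>s\<in>carrier G. \<Oplus>\<^bsub>A\<^esub>t\<in>carrier G. ?T g h s t)
       = (\<Oplus>\<^bsub>A\<^esub>h\<in>carrier G. \<Oplus>\<^bsub>A\<^esub>s\<in>carrier G. if h = r \<and> g = s \<otimes>\<^bsub>G\<^esub> r then ?Y g h s else \<zero>\<^bsub>A\<^esub>)"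
      using g Ycl by (intro A.finsum_cong' A.finsum_closed) (auto simp: t intro!: A.finsum_closed)
    also have "\<dots> = (\<Oplus>\<^bsub>A\<^esub>s\<in>carrier G. if r = r \<and> g = s \<otimes>\<^bsub>G\<^esub> r then ?Y g r s else \<zero>\<^bsub>A\<^esub>)"
      using g Ycl r by (subst finsum_single[OF r]) (auto intro!: A.finsum_closed)
    also have "\<dots> = ?Y g r (g \<otimes>\<^bsub>G\<^esub> inv\<^bsub>G\<^esub> r)"
      using g Ycl r by (subst finsum_single[of "g \<otimes>\<^bsub>G\<^esub> inv\<^bsub>G\<^esub> r"]) (auto simp: G.m_assoc)
    finally show ?thesis .
  qed
  have inj: "inj_on (\<lambda>s. s \<otimes>\<^bsub>G\<^esub> r) (carrier G)" using r by (auto simp: inj_on_def)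
  have surj: "(\<lambda>s. s \<otimes>\<^bsub>G\<^esub> r) ` carrier G = carrier G"
  proof
    show "carrier G \<subseteq> (\<lambda>s. s \<otimes>\<^bsub>G\<^esub> r) ` carrier G"
    proof
      fix g assume "g \<in> carrier G"
      then have "g = (g \<otimes>\<^bsub>G\<^esub> inv\<^bsub>G\<^esub> r) \<otimes>\<^bsub>G\<^esub> r" "g \<otimes>\<^bsub>G\<^esub> inv\<^bsub>G\<^esub> r \<in> carrier G"
        using r by (auto simp: G.m_assoc)
      then show "g \<in> (\<lambda>s. s \<otimes>\<^bsub>G\<^esub> r) ` carrier G" by blast
    qed
  qed (use r in auto)
  have "smash_mult G A gr F F' r = (\<Oplus>\<^bsub>A\<^esub>g\<in>carrier G. ?Y g r (g \<otimes>\<^bsub>G\<^esub> inv\<^bsub>G\<^esub> r))"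
  proof -
    have "smash_mult G A gr F F' r = (\<Oplus>\<^bsub>A\<^esub>g\<in>carrier G. \<Oplus>\<^bsub>A\<^esub>h\<in>carrier G. \<Oplus>\<^bsub>A\<^esub>s\<in>carrier G. \<Oplus>\<^bsub>A\<^esub>t\<in>carrier G. ?T g h s t)"
      using r by (simp add: smash_mult_def)
    also have "\<dots> = (\<Oplus>\<^bsub>A\<^esub>g\<in>carrier G. ?Y g r (g \<otimes>\<^bsub>G\<^esub> inv\<^bsub>G\<^esub> r))"
      using r Ycl by (intro A.finsum_cong' h) auto
    finally show ?thesis .
  qed
  also have "\<dots> = (\<Oplus>\<^bsub>A\<^esub>g\<in>(\<lambda>s. s \<otimes>\<^bsub>G\<^esub> r) ` carrier G. ?Y g r (g \<otimes>\<^bsub>G\<^esub> inv\<^bsub>G\<^esub> r))"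
    by (simp only: surj)
  also have "\<dots> = (\<Oplus>\<^bsub>A\<^esub>s\<in>carrier G. ?Y (s \<otimes>\<^bsub>G\<^esub> r) r (s \<otimes>\<^bsub>G\<^esub> r \<otimes>\<^bsub>G\<^esub> inv\<^bsub>G\<^esub> r))"
    using Ycl r by (intro A.finsum_reindex) (auto simp: inj)
  also have "\<dots> = (\<Oplus>\<^bsub>A\<^esub>s\<in>carrier G. ?Y (s \<otimes>\<^bsub>G\<^esub> r) r s)"
    using Ycl r by (intro A.finsum_cong') (auto simp: G.m_assoc)
  finally show ?thesis .
qed

text \<open>Sweedler form of the product, for arbitrary \<open>h\<close> and \<open>k\<close> in \<open>H\<close>.\<close>

lemma smash_tensor_mult:
  assumes x: "x \<in> carrier A" and y: "y \<in> carrier A" and r: "r \<in> carrier G"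
  shows "(smash_tensor G A x h \<otimes>\<^bsub>smash_product G A gr\<^esub> smash_tensor G A y k) r =
    (\<Oplus>\<^bsub>A\<^esub>s\<in>carrier G. \<Oplus>\<^bsub>A\<^esub>t\<in>carrier G. dual_comult G h s t \<odot>\<^bsub>A\<^esub>
       smash_tensor G A (x \<otimes>\<^bsub>A\<^esub> dual_action G A gr (dual_idem G s) y)
                        (dual_idem G t \<otimes>\<^bsub>group_dual G\<^esub> k) r)" (is "?L = ?R")
proof -
  note cl = hom_component_closed dual_action_closed smult_closed x y r
  have dual_idem_r: "dual_idem G t r = (if r = t then 1 else 0)" for t
    using r by (simp add: dual_idem_def)
  have "?L = (\<Oplus>\<^bsub>A\<^esub>s\<in>carrier G. (h (s \<otimes>\<^bsub>G\<^esub> r) \<odot>\<^bsub>A\<^esub> x) \<otimes>\<^bsub>A\<^esub> hom_component G A gr s (k r \<odot>\<^bsub>A\<^esub> y))"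
    unfolding smash_product_def monoid.simps using cl
    by (subst smash_mult_eq) (auto simp: smash_tensor_def intro!: A.finsum_cong')
  also have "\<dots> = ?R"
  proof (rule A.finsum_cong')
    fix s assume s: "s \<in> carrier G"
    have "(\<Oplus>\<^bsub>A\<^esub>t\<in>carrier G. dual_comult G h s t \<odot>\<^bsub>A\<^esub>
       smash_tensor G A (x \<otimes>\<^bsub>A\<^esub> dual_action G A gr (dual_idem G s) y)
                        (dual_idem G t \<otimes>\<^bsub>group_dual G\<^esub> k) r)
      = h (s \<otimes>\<^bsub>G\<^esub> r) \<odot>\<^bsub>A\<^esub> (k r \<odot>\<^bsub>A\<^esub> (x \<otimes>\<^bsub>A\<^esub> hom_component G A gr s y))"
      using s cl by (subst finsum_single[OF r])
        (auto simp: smash_tensor_def group_dual_def dual_action_idem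
          dual_comult_def dual_idem_r)
    also have "\<dots> = (h (s \<otimes>\<^bsub>G\<^esub> r) \<odot>\<^bsub>A\<^esub> x) \<otimes>\<^bsub>A\<^esub> hom_component G A gr s (k r \<odot>\<^bsub>A\<^esub> y)"
      using s cl by (simp add: hom_component_smult smult_mult_left smult_mult_right
        smult_assoc1[symmetric] mult.commute)
    finally show "(h (s \<otimes>\<^bsub>G\<^esub> r) \<odot>\<^bsub>A\<^esub> x) \<otimes>\<^bsub>A\<^esub> hom_component G A gr s (k r \<odot>\<^bsub>A\<^esub> y)
      = (\<Oplus>\<^bsub>A\<^esub>t\<in>carrier G. dual_comult G h s t \<odot>\<^bsub>A\<^esub>
       smash_tensor G A (x \<otimes>\<^bsub>A\<^esub> dual_action G A gr (dual_idem G s) y)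
                        (dual_idem G t \<otimes>\<^bsub>group_dual G\<^esub> k) r)" ..
  qed (auto simp: smash_tensor_def cl intro!: A.finsum_closed smult_closed)
  finally show ?thesis .
qed

lemma auslander_map_tensor:
  assumes x: "x \<in> carrier A" and y: "y \<in> carrier A"
  shows "auslander_map G A gr (smash_tensor G A x h) y = x \<otimes>\<^bsub>A\<^esub> dual_action G A gr h y"
proof -
  note cl = hom_component_closed dual_action_closed smult_closed x y
  have "auslander_map G A gr (smash_tensor G A x h) y
      = (\<Oplus>\<^bsub>A\<^esub>g\<in>carrier G. x \<otimes>\<^bsub>A\<^esub> (h g \<odot>\<^bsub>A\<^esub> hom_component G A gr g y))"
    unfolding auslander_map_def using cl
    by (auto simp: smash_tensor_def dual_action_idem smult_mult_left smult_mult_right intro!: A.finsum_cong')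
  also have "\<dots> = x \<otimes>\<^bsub>A\<^esub> dual_action G A gr h y"
    unfolding dual_action_def using cl finite_G by (subst A.finsum_rdistr) auto
  finally show ?thesis .
qed

end


section \<open>The algebra on two generators with equal squares\<close>

datatype uv = Gen_u | Gen_v

definition uv_ideal :: "(uv, 'k::field) free_alg_elem set" where
  "uv_ideal = Idl\<^bsub>free_algebra\<^esub> {free_gen Gen_u * free_gen Gen_u - free_gen Gen_v * free_gen Gen_v}"

definition uv_algebra :: "('k::field, (uv, 'k) free_alg_elem set) module" where
  "uv_algebra = quotient_algebra free_algebra uv_ideal"

fun uv_deg :: "'g \<Rightarrow> 'g \<Rightarrow> uv \<Rightarrow> 'g" where
  "uv_deg a b Gen_u = a"
| "uv_deg a b Gen_v = b"

definition word_deg :: "('g, 'm) monoid_scheme \<Rightarrow> ('x \<Rightarrow> 'g) \<Rightarrow> 'x free_word \<Rightarrow> 'g" where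
  "word_deg G d w = foldr (\<lambda>x g. d x \<otimes>\<^bsub>G\<^esub> g) (letters w) \<one>\<^bsub>G\<^esub>"

abbreviation uv_class :: "(uv, 'k::field) free_alg_elem \<Rightarrow> (uv, 'k) free_alg_elem set" where
  "uv_class p \<equiv> uv_ideal +>\<^bsub>free_algebra\<^esub> p"

text \<open>The component of degree \<open>g\<close> is spanned by the images of the words of degree \<open>g\<close>.\<close>

definition uv_grading ::
  "('g, 'm) monoid_scheme \<Rightarrow> 'g \<Rightarrow> 'g \<Rightarrow> 'g \<Rightarrow> (uv, 'k::field) free_alg_elem set set" where
  "uv_grading G a b g =
     {uv_class p | p. \<forall>w \<in> Poly_Mapping.keys p. word_deg G (uv_deg a b) w = g}"


lemma free_algebra_simps [simp]:
  "carrier free_algebra = UNIV" "x \<otimes>\<^bsub>free_algebra\<^esub> y = x * y" "\<one>\<^bsub>free_algebra\<^esub> = 1"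
  "\<zero>\<^bsub>free_algebra\<^esub> = 0" "x \<oplus>\<^bsub>free_algebra\<^esub> y = x + y"
  "c \<odot>\<^bsub>free_algebra\<^esub> x = Poly_Mapping.single 0 c * x"
  by (simp_all add: free_algebra_def)

lemma ring_free_algebra: "ring (free_algebra :: ('k::field, ('x, 'k) free_alg_elem) module)"
  (is "ring ?A")
proof (rule ringI)
  show "abelian_group ?A"
  proof (rule abelian_groupI)
    show "\<exists>y\<in>carrier free_algebra. y \<oplus>\<^bsub>free_algebra\<^esub> x = \<zero>\<^bsub>free_algebra\<^esub>"
      for x :: "('x, 'k) free_alg_elem"
      by (rule bexI[of _ "- x"]) auto
  qed (auto simp: algebra_simps)
  show "Group.monoid ?A" by (rule monoidI) (auto simp: mult.assoc)
qed (auto simp: algebra_simps)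

lemma a_inv_free_algebra [simp]:
  fixes x :: "('x, 'k::field) free_alg_elem"
  shows "\<ominus>\<^bsub>free_algebra\<^esub> x = - x"
proof -
  interpret ring "free_algebra :: ('k::field, ('x, 'k) free_alg_elem) module"
    by (rule ring_free_algebra)
  show ?thesis by (rule minus_equality) auto
qed

lemma ideal_uv_ideal: "ideal uv_ideal free_algebra"
  unfolding uv_ideal_def by (rule ring.genideal_ideal[OF ring_free_algebra]) simp

lemmas additive_subgroup_uv_ideal = ideal.axioms(1)[OF ideal_uv_ideal]

lemma uv_ideal_closed:
  fixes p q :: "(uv, 'k::field) free_alg_elem"
  shows "0 \<in> (uv_ideal :: (uv, 'k) free_alg_elem set)"
    and "p \<in> uv_ideal \<Longrightarrow> q \<in> uv_ideal \<Longrightarrow> p + q \<in> uv_ideal"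
    and "p \<in> uv_ideal \<Longrightarrow> - p \<in> uv_ideal"
    and "p \<in> uv_ideal \<Longrightarrow> q * p \<in> uv_ideal"
    and "p \<in> uv_ideal \<Longrightarrow> p * q \<in> uv_ideal"
  using additive_subgroup.zero_closed[OF additive_subgroup_uv_ideal]
    additive_subgroup.a_closed[OF additive_subgroup_uv_ideal, of p q]
    ideal.I_l_closed[OF ideal_uv_ideal, of p q] ideal.I_r_closed[OF ideal_uv_ideal, of p q]
    ideal.I_l_closed[OF ideal_uv_ideal, of p "- 1"]
  by auto

lemma carrier_uv_algebra: "carrier uv_algebra = range uv_class"
  by (auto simp: uv_algebra_def quotient_algebra_def ring.defs FactRing_def A_RCOSETS_def'
      a_r_coset_def')

lemma uv_class_eq_iff:
  fixes p q :: "(uv, 'a::field) free_alg_elem"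
  shows "uv_class p = uv_class q \<longleftrightarrow> p - q \<in> uv_ideal"
proof -
  have mem: "x \<in> uv_class y \<longleftrightarrow> x - y \<in> uv_ideal" for x y :: "(uv, 'a) free_alg_elem"
    by (force simp: a_r_coset_def' intro!: exI[of _ "x - y"])
  show ?thesis
  proof
    assume "uv_class p = uv_class q"
    then show "p - q \<in> uv_ideal" using mem[of p p] mem[of p q] uv_ideal_closed(1) by simp
  next
    assume pq: "p - q \<in> uv_ideal"
    show "uv_class p = uv_class q"
    proof (rule Set.set_eqI)
      fix x
      have "x - q = (x - p) + (p - q)" "x - p = (x - q) + - (p - q)" by simp_all
      then show "x \<in> uv_class p \<longleftrightarrow> x \<in> uv_class q"
        unfolding mem using pq uv_ideal_closed(2,3) by metis
    qed
  qed
qed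

lemma uv_algebra_simps:
  "\<one>\<^bsub>uv_algebra\<^esub> = uv_class 1" "\<zero>\<^bsub>uv_algebra\<^esub> = uv_class 0"
  "uv_class p \<otimes>\<^bsub>uv_algebra\<^esub> uv_class q = uv_class (p * q)"
  "uv_class p \<oplus>\<^bsub>uv_algebra\<^esub> uv_class q = uv_class (p + q)"
  "c \<odot>\<^bsub>uv_algebra\<^esub> uv_class p = uv_class (Poly_Mapping.single 0 c * p)"
proof -
  have z: "uv_class 0 = uv_ideal" by (auto simp: a_r_coset_def')
  show "\<one>\<^bsub>uv_algebra\<^esub> = uv_class 1" "\<zero>\<^bsub>uv_algebra\<^esub> = uv_class 0"
  "uv_class p \<otimes>\<^bsub>uv_algebra\<^esub> uv_class q = uv_class (p * q)"
  "uv_class p \<oplus>\<^bsub>uv_algebra\<^esub> uv_class q = uv_class (p + q)"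
  "c \<odot>\<^bsub>uv_algebra\<^esub> uv_class p = uv_class (Poly_Mapping.single 0 c * p)"
  using ideal.rcoset_mult_add[OF ideal_uv_ideal, of p q] ideal.a_rcos_sum[OF ideal_uv_ideal, of p q] ideal.rcoset_mult_add[OF ideal_uv_ideal, of "Poly_Mapping.single 0 c" p]
  by (simp_all add: uv_algebra_def quotient_algebra_def ring.defs module.defs FactRing_def z)
qed

lemma ring_uv_algebra: "ring (uv_algebra :: ('k::field, (uv, 'k) free_alg_elem set) module)"
  (is "ring ?A")
proof (rule ringI)
  show "abelian_group ?A"
  proof (rule abelian_groupI)
    show "\<exists>y\<in>carrier uv_algebra. y \<oplus>\<^bsub>uv_algebra\<^esub> x = \<zero>\<^bsub>uv_algebra\<^esub>"
      if "x \<in> carrier uv_algebra" for x :: "(uv, 'k) free_alg_elem set"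
    proof -
      from that obtain p where "x = uv_class p" by (auto simp: carrier_uv_algebra)
      then show ?thesis
        by (intro bexI[of _ "uv_class (- p)"]) (auto simp: carrier_uv_algebra uv_algebra_simps)
    qed
  qed (auto simp: algebra_simps carrier_uv_algebra uv_algebra_simps)
  show "Group.monoid ?A"
    by (rule monoidI) (auto simp: mult.assoc carrier_uv_algebra uv_algebra_simps)
qed (auto simp: algebra_simps carrier_uv_algebra uv_algebra_simps)

lemma uv_class_sum:
  fixes f :: "'i \<Rightarrow> (uv, 'k::field) free_alg_elem"
  shows "finite S \<Longrightarrow> (\<Oplus>\<^bsub>uv_algebra\<^esub>i\<in>S. uv_class (f i)) = uv_class (\<Sum>i\<in>S. f i)"
proof (induction S rule: finite_induct)
  case empty
  interpret ring "uv_algebra :: ('k, (uv, 'k) free_alg_elem set) module" by (rule ring_uv_algebra)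
  show ?case by (simp add: uv_algebra_simps)
next
  case (insert x F)
  interpret ring "uv_algebra :: ('k, (uv, 'k) free_alg_elem set) module" by (rule ring_uv_algebra)
  from insert show ?case by (subst finsum_insert) (auto simp: uv_algebra_simps carrier_uv_algebra)
qed

definition supp_part :: "('x free_word \<Rightarrow> bool) \<Rightarrow> ('x, 'k::field) free_alg_elem \<Rightarrow> ('x, 'k) free_alg_elem" where
  "supp_part P p = Poly_Mapping.mapp (\<lambda>w c. c when P w) p"

lemma lookup_supp_part: "Poly_Mapping.lookup (supp_part P p) w = (Poly_Mapping.lookup p w when P w)"
  by (auto simp: supp_part_def lookup_mapp when_def in_keys_iff)

lemma supp_part_plus: "supp_part P (p + q) = supp_part P p + supp_part P q"
  by (rule poly_mapping_eqI) (simp add: lookup_supp_part lookup_add when_def)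

lemma supp_part_minus: "supp_part P (p - q) = supp_part P p - supp_part P q"
  by (rule poly_mapping_eqI) (simp add: lookup_supp_part lookup_minus when_def)

lemma supp_part_uminus: "supp_part P (- p) = - supp_part P p"
  by (rule poly_mapping_eqI) (simp add: lookup_supp_part when_def)

lemma supp_part_zero [simp]: "supp_part P 0 = 0"
  by (rule poly_mapping_eqI) (simp add: lookup_supp_part when_def)

lemma supp_part_sum: "supp_part P (\<Sum>i\<in>S. f i) = (\<Sum>i\<in>S. supp_part P (f i))"
  by (induction S rule: infinite_finite_induct) (simp_all add: supp_part_plus)

lemma supp_part_single:
  "supp_part P (Poly_Mapping.single w c) = (if P w then Poly_Mapping.single w c else 0)"
  by (rule poly_mapping_eqI) (auto simp: lookup_supp_part lookup_single when_def)

lemma supp_part_id: "(\<And>w. w \<in> Poly_Mapping.keys p \<Longrightarrow> P w) \<Longrightarrow> supp_part P p = p"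
  by (rule poly_mapping_eqI) (metis lookup_supp_part in_keys_iff when_def)

lemma supp_part_none: "(\<And>w. w \<in> Poly_Mapping.keys p \<Longrightarrow> \<not> P w) \<Longrightarrow> supp_part P p = 0"
  by (rule poly_mapping_eqI) (metis lookup_supp_part in_keys_iff when_def lookup_zero)

lemma free_alg_sum_single: "p = (\<Sum>w\<in>Poly_Mapping.keys p. Poly_Mapping.single w (Poly_Mapping.lookup p w))"
  by (rule poly_mapping_eqI) (auto simp: lookup_sum lookup_single when_def in_keys_iff)

lemma single_0_central: "Poly_Mapping.single 0 c * p = p * Poly_Mapping.single 0 c"
  for p :: "('x, 'k::field) free_alg_elem"
proof -
  have "Poly_Mapping.single 0 c * Poly_Mapping.single w d = Poly_Mapping.single w d * Poly_Mapping.single 0 c"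
    for w :: "'x free_word" and d :: 'k
    by (simp add: mult_single mult.commute)
  then show ?thesis
    by (subst (1 2) free_alg_sum_single[of p]) (simp add: sum_distrib_left sum_distrib_right)
qed

context
  fixes G :: "('g, 'm) monoid_scheme" (structure) and a b :: 'g
  assumes G: "group G" and finG: "finite (carrier G)"
    and ab: "a \<in> carrier G" "b \<in> carrier G" "a \<otimes> a = b \<otimes> b"
begin

interpretation G: group G by (rule G)

private abbreviation (input) dg where "dg \<equiv> word_deg G (uv_deg a b)"

lemma uv_deg_closed: "uv_deg a b x \<in> carrier G"
  using ab by (cases x) auto

lemma word_deg_closed: "dg w \<in> carrier G"
proof -
  have "foldr (\<lambda>x g. uv_deg a b x \<otimes> g) xs \<one> \<in> carrier G" for xs
    using uv_deg_closed by (induction xs) auto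
  then show ?thesis by (simp add: word_deg_def)
qed

lemma word_deg_plus: "dg (v + w) = dg v \<otimes> dg w"
proof -
  have *: "foldr (\<lambda>x g. uv_deg a b x \<otimes> g) (xs @ ys) \<one> =
     foldr (\<lambda>x g. uv_deg a b x \<otimes> g) xs \<one> \<otimes> foldr (\<lambda>x g. uv_deg a b x \<otimes> g) ys \<one>" for xs ys
    using uv_deg_closed word_deg_closed[of "Word _"]
    by (induction xs) (auto simp: G.m_assoc word_deg_def)
  then show ?thesis by (simp add: word_deg_def plus_free_word_def)
qed

lemma word_deg_zero: "dg 0 = \<one>"
  by (simp add: word_deg_def zero_free_word_def)

private abbreviation (input) part where "part g \<equiv> supp_part (\<lambda>w. dg w = g)"

lemma part_single_left:
  assumes "g \<in> carrier G"
  shows "part g (Poly_Mapping.single w c * p) = Poly_Mapping.single w c * part (inv dg w \<otimes> g) p"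
proof -
  have *: "part g (Poly_Mapping.single w c * Poly_Mapping.single v d)
     = Poly_Mapping.single w c * part (inv dg w \<otimes> g) (Poly_Mapping.single v d)" for v d
    using assms word_deg_closed[of w] word_deg_closed[of v]
    by (auto simp: mult_single supp_part_single word_deg_plus G.m_assoc[symmetric])
  show ?thesis
    by (subst (1 2) free_alg_sum_single[of p]) (simp add: sum_distrib_left supp_part_sum *)
qed

lemma part_single_right:
  assumes "g \<in> carrier G"
  shows "part g (p * Poly_Mapping.single w c) = part (g \<otimes> inv dg w) p * Poly_Mapping.single w c"
proof -
  have *: "part g (Poly_Mapping.single v d * Poly_Mapping.single w c)
     = part (g \<otimes> inv dg w) (Poly_Mapping.single v d) * Poly_Mapping.single w c" for v d
    using assms word_deg_closed[of w] word_deg_closed[of v]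
    by (auto simp: mult_single supp_part_single word_deg_plus G.m_assoc)
  show ?thesis
    by (subst (1 2) free_alg_sum_single[of p]) (simp add: sum_distrib_right supp_part_sum *)
qed

lemma uv_ideal_sum: "(\<And>i. i \<in> S \<Longrightarrow> f i \<in> uv_ideal) \<Longrightarrow> (\<Sum>i\<in>S. f i) \<in> uv_ideal"
  using uv_ideal_closed
  by (induction S rule: infinite_finite_induct) auto

lemma uv_ideal_part:
  fixes p :: "(uv, 'k::field) free_alg_elem"
  assumes "p \<in> uv_ideal" "g \<in> carrier G"
  shows "part g p \<in> uv_ideal"
proof -
  let ?J = "{p :: (uv, 'k) free_alg_elem. \<forall>g\<in>carrier G. part g p \<in> uv_ideal}"
  interpret F: ring "free_algebra :: ('k, (uv, 'k) free_alg_elem) module"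
    by (rule ring_free_algebra)
  have "ideal ?J free_algebra"
  proof (rule idealI[OF ring_free_algebra])
    show "subgroup ?J (add_monoid free_algebra)"
    proof (rule group.subgroupI[OF F.a_group])
      show "?J \<noteq> {}" using uv_ideal_closed by (auto intro!: exI[of _ 0])
      fix p q :: "(uv, 'k) free_alg_elem" assume p: "p \<in> ?J"
      have "inv\<^bsub>add_monoid free_algebra\<^esub> p = - p" using a_inv_free_algebra[of p] by (simp add: a_inv_def)
      then show "inv\<^bsub>add_monoid free_algebra\<^esub> p \<in> ?J"
        using p uv_ideal_closed by (auto simp: supp_part_uminus)
      assume "q \<in> ?J"
      then show "p \<otimes>\<^bsub>add_monoid free_algebra\<^esub> q \<in> ?J"
        using p uv_ideal_closed by (auto simp: supp_part_plus)
    qed auto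
    fix p x :: "(uv, 'k) free_alg_elem" assume p: "p \<in> ?J"
    show "x \<otimes>\<^bsub>free_algebra\<^esub> p \<in> ?J"
    proof safe
      fix g assume g: "g \<in> carrier G"
      have "part g (x * p) = (\<Sum>w\<in>Poly_Mapping.keys x.
          Poly_Mapping.single w (Poly_Mapping.lookup x w) * part (inv dg w \<otimes> g) p)"
        by (subst free_alg_sum_single[of x]) (simp add: sum_distrib_right supp_part_sum part_single_left g)
      also have "\<dots> \<in> uv_ideal"
        using p g word_deg_closed by (intro uv_ideal_sum) (auto intro!: uv_ideal_closed(4))
      finally show "part g (x \<otimes>\<^bsub>free_algebra\<^esub> p) \<in> uv_ideal" by simp
    qed
    show "p \<otimes>\<^bsub>free_algebra\<^esub> x \<in> ?J"
    proof safe
      fix g assume g: "g \<in> carrier G"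
      have "part g (p * x) = (\<Sum>w\<in>Poly_Mapping.keys x.
          part (g \<otimes> inv dg w) p * Poly_Mapping.single w (Poly_Mapping.lookup x w))"
        by (subst free_alg_sum_single[of x]) (simp add: sum_distrib_left supp_part_sum part_single_right g)
      also have "\<dots> \<in> uv_ideal"
        using p g word_deg_closed by (intro uv_ideal_sum) (auto intro!: uv_ideal_closed(5))
      finally show "part g (p \<otimes>\<^bsub>free_algebra\<^esub> x) \<in> uv_ideal" by simp
    qed
  qed
  moreover have "free_gen Gen_u * free_gen Gen_u - free_gen Gen_v * free_gen Gen_v \<in> ?J"
  proof safe
    fix g assume "g \<in> carrier G"
    have gen: "(free_gen Gen_u * free_gen Gen_u - free_gen Gen_v * free_gen Gen_v :: (uv, 'k) free_alg_elem) \<in> uv_ideal"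
      unfolding uv_ideal_def by (rule F.genideal_self') simp
    show "part g (free_gen Gen_u * free_gen Gen_u - free_gen Gen_v * free_gen Gen_v :: (uv, 'k) free_alg_elem) \<in> uv_ideal"
      using gen uv_ideal_closed ab
      by (cases "g = a \<otimes> a")
        (auto simp: free_gen_def mult_single supp_part_minus supp_part_single plus_free_word_def word_deg_def)
  qed
  ultimately have "uv_ideal \<subseteq> ?J"
    unfolding uv_ideal_def[where 'k='k] by (intro F.genideal_minimal) auto
  then show ?thesis using assms by blast
qed

theorem graded_algebra_uv: "graded_algebra G
  (uv_algebra :: ('k::field, (uv, 'k) free_alg_elem set) module) (uv_grading G a b)"
proof -
  interpret A: ring "uv_algebra :: ('k, (uv, 'k) free_alg_elem set) module"
    by (rule ring_uv_algebra)
  note S = carrier_uv_algebra uv_algebra_simps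
  have mem: "x \<in> uv_grading G a b g \<longleftrightarrow> (\<exists>p. x = uv_class (part g p))"
    for x :: "(uv, 'k) free_alg_elem set" and g
  proof
    assume "x \<in> uv_grading G a b g"
    then obtain p where "x = uv_class p" "\<forall>w\<in>Poly_Mapping.keys p. dg w = g"
      by (auto simp: uv_grading_def)
    then show "\<exists>p. x = uv_class (part g p)"
      by (auto intro!: exI[of _ p] simp: supp_part_id)
  next
    assume "\<exists>p. x = uv_class (part g p)"
    then show "x \<in> uv_grading G a b g"
      unfolding uv_grading_def by (force simp: in_keys_iff lookup_supp_part)
  qed
  have part_part: "part g (part h p) = (if g = h then part g p else 0)"
    for g h and p :: "(uv, 'k) free_alg_elem"
    by (rule poly_mapping_eqI) (auto simp: lookup_supp_part when_def)
  have part_sum: "(\<Sum>g\<in>carrier G. part g p) = p" for p :: "(uv, 'k) free_alg_elem"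
    using finG word_deg_closed by (intro poly_mapping_eqI) (auto simp: lookup_sum lookup_supp_part when_def)
  have part_smult: "Poly_Mapping.single 0 c * part g p = part g (Poly_Mapping.single 0 c * p)"
    if "g \<in> carrier G" for c g and p :: "(uv, 'k) free_alg_elem"
    using part_single_left[OF that, of 0 c p] that by (simp add: word_deg_zero)
  have minus: "inv\<^bsub>add_monoid uv_algebra\<^esub> uv_class p = uv_class (- p)" for p :: "(uv, 'k) free_alg_elem"
    using A.minus_equality[of "uv_class (- p)" "uv_class p"] by (simp add: S a_inv_def)
  show ?thesis
  proof (intro graded_algebra.intro graded_algebra_axioms.intro)
    show "additive_subgroup (uv_grading G a b g) (uv_algebra :: ('k, (uv, 'k) free_alg_elem set) module)"
      if g: "g \<in> carrier G" for g
    proof (rule additive_subgroup.intro, rule group.subgroupI[OF A.a_group])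
      show "(uv_grading G a b g :: (uv, 'k) free_alg_elem set set) \<noteq> {}"
        unfolding uv_grading_def by (auto intro: exI[of _ 0])
      fix x y :: "(uv, 'k) free_alg_elem set"
      assume x: "x \<in> uv_grading G a b g"
      then obtain p where p: "x = uv_class (part g p)" by (auto simp: mem)
      show "inv\<^bsub>add_monoid uv_algebra\<^esub> x \<in> uv_grading G a b g"
        unfolding p minus by (auto simp: mem supp_part_uminus[symmetric])
      assume "y \<in> uv_grading G a b g"
      then show "x \<otimes>\<^bsub>add_monoid uv_algebra\<^esub> y \<in> uv_grading G a b g"
        using x by (auto simp: mem S supp_part_plus[symmetric])
    qed (auto simp: mem S)
    show "c \<odot>\<^bsub>uv_algebra\<^esub> x \<in> uv_grading G a b g" if "g \<in> carrier G" "x \<in> uv_grading G a b g"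
      for c g and x :: "(uv, 'k) free_alg_elem set"
      using that part_smult[of g c] by (auto simp: mem S)
    show "x \<otimes>\<^bsub>uv_algebra\<^esub> y \<in> uv_grading G a b (g \<otimes> h)"
      if gh: "g \<in> carrier G" "h \<in> carrier G" "x \<in> uv_grading G a b g" "y \<in> uv_grading G a b h"
      for g h and x y :: "(uv, 'k) free_alg_elem set"
    proof -
      from gh obtain p q where x: "x = uv_class p" "\<And>w. w \<in> Poly_Mapping.keys p \<Longrightarrow> dg w = g"
        and y: "y = uv_class q" "\<And>w. w \<in> Poly_Mapping.keys q \<Longrightarrow> dg w = h"
        by (auto simp: uv_grading_def)
      have "dg w = g \<otimes> h" if "w \<in> Poly_Mapping.keys (p * q)" for w
        using that keys_mult[of p q] x y by (auto simp: word_deg_plus)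
      then show ?thesis using x(1) y(1) by (auto simp: uv_grading_def S)
    qed
    show "\<exists>!f. f \<in> (\<Pi>\<^sub>E g\<in>carrier G. uv_grading G a b g) \<and> x = (\<Oplus>\<^bsub>uv_algebra\<^esub>g\<in>carrier G. f g)"
      if x: "x \<in> carrier uv_algebra" for x :: "(uv, 'k) free_alg_elem set"
    proof -
      from x obtain p where p: "x = uv_class p" by (auto simp: S)
      have sum: "(\<Oplus>\<^bsub>uv_algebra\<^esub>g\<in>carrier G. f g) = uv_class (\<Sum>g\<in>carrier G. P g)"
        if "\<And>g. g \<in> carrier G \<Longrightarrow> f g = uv_class (P g)" for f and P :: "'g \<Rightarrow> (uv, 'k) free_alg_elem"
      proof -
        have "(\<Oplus>\<^bsub>uv_algebra\<^esub>g\<in>carrier G. f g) = (\<Oplus>\<^bsub>uv_algebra\<^esub>g\<in>carrier G. uv_class (P g))"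
          by (rule A.finsum_cong') (simp_all add: that carrier_uv_algebra)
        then show ?thesis by (simp add: uv_class_sum[OF finG])
      qed
      show ?thesis
      proof (rule ex1I)
        show "(\<lambda>g\<in>carrier G. uv_class (part g p)) \<in> (\<Pi>\<^sub>E g\<in>carrier G. uv_grading G a b g) \<and>
          x = (\<Oplus>\<^bsub>uv_algebra\<^esub>g\<in>carrier G. (\<lambda>g\<in>carrier G. uv_class (part g p)) g)"
          by (subst sum[of _ "\<lambda>g. part g p"]) (auto simp: mem part_sum p)
      next
        fix f assume f: "f \<in> (\<Pi>\<^sub>E g\<in>carrier G. uv_grading G a b g) \<and>
          x = (\<Oplus>\<^bsub>uv_algebra\<^esub>g\<in>carrier G. f g)"
        then have "\<forall>g\<in>carrier G. \<exists>q. f g = uv_class (part g q)" by (auto simp: mem)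
        then obtain q where q: "\<And>g. g \<in> carrier G \<Longrightarrow> f g = uv_class (part g (q g))" by metis
        have "uv_class p = uv_class (\<Sum>g\<in>carrier G. part g (q g))"
          using f sum[of f "\<lambda>g. part g (q g)"] q p by simp
        then have I: "p - (\<Sum>g\<in>carrier G. part g (q g)) \<in> uv_ideal" by (simp add: uv_class_eq_iff)
        have "f g = uv_class (part g p)" if g: "g \<in> carrier G" for g
        proof -
          have "part g (p - (\<Sum>h\<in>carrier G. part h (q h))) = part g p - part g (q g)"
            using finG g by (simp add: supp_part_minus supp_part_sum part_part)
          then have "part g p - part g (q g) \<in> uv_ideal" using uv_ideal_part[OF I g] by simp
          then show ?thesis using q[OF g] by (metis uv_class_eq_iff)
        qed
        then show "f = (\<lambda>g\<in>carrier G. uv_class (part g p))"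
          using f by (intro extensionalityI[of _ "carrier G"]) (auto simp: PiE_def)
      qed
    qed
  next
    fix c d :: 'k and x y :: "(uv, 'k) free_alg_elem set"
    assume "x \<in> carrier uv_algebra" "y \<in> carrier uv_algebra"
    then obtain p q where pq: "x = uv_class p" "y = uv_class q" by (auto simp: carrier_uv_algebra)
    show "c \<odot>\<^bsub>uv_algebra\<^esub> (x \<oplus>\<^bsub>uv_algebra\<^esub> y) =
        c \<odot>\<^bsub>uv_algebra\<^esub> x \<oplus>\<^bsub>uv_algebra\<^esub> c \<odot>\<^bsub>uv_algebra\<^esub> y"
      by (simp add: pq uv_algebra_simps distrib_left)
    show "(c \<odot>\<^bsub>uv_algebra\<^esub> x) \<otimes>\<^bsub>uv_algebra\<^esub> y = c \<odot>\<^bsub>uv_algebra\<^esub> (x \<otimes>\<^bsub>uv_algebra\<^esub> y)"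
      by (simp add: pq uv_algebra_simps mult.assoc)
    have "q * (Poly_Mapping.single 0 c * p) = Poly_Mapping.single 0 c * (q * p)" for p q :: "(uv, 'k) free_alg_elem"
      by (metis mult.assoc single_0_central)
    then show "x \<otimes>\<^bsub>uv_algebra\<^esub> (c \<odot>\<^bsub>uv_algebra\<^esub> y) = c \<odot>\<^bsub>uv_algebra\<^esub> (x \<otimes>\<^bsub>uv_algebra\<^esub> y)"
      by (simp add: pq uv_algebra_simps)
  next
    fix c d :: 'k and x :: "(uv, 'k) free_alg_elem set"
    assume "x \<in> carrier uv_algebra"
    then obtain p where p: "x = uv_class p" by (auto simp: carrier_uv_algebra)
    show "c \<odot>\<^bsub>uv_algebra\<^esub> x \<in> carrier uv_algebra"
      by (simp add: p uv_algebra_simps carrier_uv_algebra)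
    show "(c + d) \<odot>\<^bsub>uv_algebra\<^esub> x = c \<odot>\<^bsub>uv_algebra\<^esub> x \<oplus>\<^bsub>uv_algebra\<^esub> d \<odot>\<^bsub>uv_algebra\<^esub> x"
      by (simp add: p uv_algebra_simps single_add distrib_right)
    have "Poly_Mapping.single 0 (c * d) * p = Poly_Mapping.single 0 c * (Poly_Mapping.single 0 d * p)"
      by (simp add: mult.assoc[symmetric] mult_single)
    then show "(c * d) \<odot>\<^bsub>uv_algebra\<^esub> x = c \<odot>\<^bsub>uv_algebra\<^esub> (d \<odot>\<^bsub>uv_algebra\<^esub> x)"
      by (simp add: p uv_algebra_simps)
    show "1 \<odot>\<^bsub>uv_algebra\<^esub> x = x"
      by (simp add: p uv_algebra_simps)
  qed (rule finG G A.ring_axioms)+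
qed

lemma uv_grading_generators:
  "uv_class (free_gen Gen_u) \<in> uv_grading G a b a"
  "uv_class (free_gen Gen_v) \<in> uv_grading G a b b"
  using ab by (force simp: uv_grading_def free_gen_def word_deg_def)+

end

end

theory Submission
  imports Defs
begin

text \<open>
  The algebra \<open>A\<close> is a monoid algebra: its defining relation equates two words, so \<open>A\<close> has a basis
  consisting of the elements of the monoid \<open>M\<close> presented by \<open>u\<^sup>2 = v\<^sup>2\<close>.  This monoid embeds into the
  group \<open>\<Gamma>\<close> with the same presentation, the fundamental group of the Klein bottle, which is a
  semidirect product of \<open>\<int>\<close> with \<open>\<int>\<close>; in these coordinates \<open>M\<close> is cut out by two inequalities
  (\<open>weight_mem\<close>, \<open>weight_surj\<close>), and words with the same value in \<open>\<Gamma>\<close> are linked by the relation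
  (\<open>weight_eq_induct\<close>).  The map from \<open>u\<close> to \<open>a\<close> and \<open>v\<close> to \<open>b\<close> extends to a homomorphism from \<open>\<Gamma>\<close>
  onto \<open>G\<close>.  Write \<open>M\<^sub>g\<close> for the elements of \<open>M\<close> of degree \<open>g\<close>; they span \<open>A\<^sub>g\<close>, and \<open>A\<^sup>H = A\<^sub>1\<close>.

  An element \<open>F\<close> of the smash product is a family of elements \<open>F(g)\<close> of \<open>A\<close>, and its Auslander map sends
  \<open>y\<close> of degree \<open>g\<close> to \<open>F(g) y\<close>.  Since monomials can be cancelled in the group algebra of \<open>\<Gamma>\<close>, this is
  injective.  Conversely let \<open>f\<close> be linear over \<open>A\<^sub>1\<close> on the right.  Two monomials \<open>m\<close>, \<open>n\<close> of one degree
  satisfy \<open>m r = n z\<close> for monomials \<open>r\<close>, \<open>z\<close> of degree \<open>1\<close>, where \<open>z\<close> is a power of \<open>u\<^sup>2\<close>, hence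
  \<open>f(m) m\<^sup>-\<^sup>1 = f(n) n\<^sup>-\<^sup>1\<close> in the group algebra of \<open>\<Gamma>\<close> (\<open>endomorphism_of_klein_single\<close>).  So \<open>f\<close> is always
  given by a family \<open>F(g)\<close> in this larger algebra, with the property that \<open>F(g) m\<close> lies in \<open>A\<close> for all \<open>m\<close>
  in \<open>M\<^sub>g\<close>.  The Auslander map is therefore surjective if and only if \<open>x M\<^sub>g \<subseteq> M\<close> implies \<open>x \<in> M\<close>, for all
  \<open>x\<close> in \<open>\<Gamma>\<close> and \<open>g\<close> in \<open>G\<close>.

  An element of \<open>\<Gamma>\<close> is a power of the central element \<open>u\<^sup>2\<close> times an alternating word in \<open>u\<close> and \<open>v\<close>, and it
  is in \<open>M\<close> exactly if the exponent is not negative.  For \<open>x\<close> outside \<open>M\<close> one may assume, multiplying by a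
  power of \<open>u\<^sup>2\<close>, that \<open>x = u\<^sup>-\<^sup>2 w\<close> with \<open>w\<close> alternating; then \<open>x m\<close> avoids \<open>M\<close> exactly if \<open>m\<close> is an
  alternating word and no letters cancel between \<open>w\<close> and \<open>m\<close>.  The condition thus says that each \<open>g\<close> is
  the degree of an alternating word starting with \<open>u\<close> and of one starting with \<open>v\<close>, the empty word being
  counted in both cases (\<open>saturated_iff\<close>).  The degrees of the former are the \<open>(ab)\<^sup>j\<close> and \<open>(ab)\<^sup>j a\<close>.  As
  \<open>G\<close> is not abelian, \<open>a\<close> is not a power of \<open>ab\<close>, so these are exactly \<open>2 |ab|\<close> elements, and they exhaust \<open>G\<close> if and only if
  \<open>|G| = 2 |ab|\<close>; the words starting with \<open>v\<close> give the same condition because \<open>|ba| = |ab|\<close>.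
\<close>

section \<open>The Auslander map of a graded algebra\<close>

context graded_algebra
begin

lemma hom_component_homogeneous:
  assumes h: "h \<in> carrier G" and g: "g \<in> carrier G" and y: "y \<in> gr h"
  shows "hom_component G A gr g y = (if g = h then y else \<zero>\<^bsub>A\<^esub>)"
proof (rule hom_component_unique)
  have yc: "y \<in> carrier A" using h y gr_carrier by blast
  show "(if k = h then y else \<zero>\<^bsub>A\<^esub>) \<in> gr k" if "k \<in> carrier G" for k
    using y additive_subgroup.zero_closed[OF gr_subgroup[OF that]] by auto
  show "y = (\<Oplus>\<^bsub>A\<^esub>k\<in>carrier G. if k = h then y else \<zero>\<^bsub>A\<^esub>)"
    using h yc by (subst finsum_single[of h]) auto
qed (rule g)

lemma hom_component_add:
  assumes g: "g \<in> carrier G" and x: "x \<in> carrier A" and y: "y \<in> carrier A"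
  shows "hom_component G A gr g (x \<oplus>\<^bsub>A\<^esub> y) = hom_component G A gr g x \<oplus>\<^bsub>A\<^esub> hom_component G A gr g y"
proof (rule hom_component_unique)
  show "hom_component G A gr k x \<oplus>\<^bsub>A\<^esub> hom_component G A gr k y \<in> gr k" if "k \<in> carrier G" for k
    using additive_subgroup.a_closed[OF gr_subgroup[OF that]] hom_component_mem that x y by blast
  have "x \<oplus>\<^bsub>A\<^esub> y = (\<Oplus>\<^bsub>A\<^esub>k\<in>carrier G. hom_component G A gr k x) \<oplus>\<^bsub>A\<^esub> (\<Oplus>\<^bsub>A\<^esub>k\<in>carrier G. hom_component G A gr k y)"
    using hom_component_sum x y by simp
  also have "\<dots> = (\<Oplus>\<^bsub>A\<^esub>k\<in>carrier G. hom_component G A gr k x \<oplus>\<^bsub>A\<^esub> hom_component G A gr k y)"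
    using x y hom_component_closed by (subst A.finsum_addf) auto
  finally show "x \<oplus>\<^bsub>A\<^esub> y = \<dots>" .
qed (rule g)

lemma finsum_right_translate:
  assumes r: "r \<in> carrier G" and f: "\<And>g. g \<in> carrier G \<Longrightarrow> f g \<in> carrier A"
  shows "(\<Oplus>\<^bsub>A\<^esub>g\<in>carrier G. f g) = (\<Oplus>\<^bsub>A\<^esub>s\<in>carrier G. f (s \<otimes>\<^bsub>G\<^esub> r))"
proof -
  have img: "(\<lambda>s. s \<otimes>\<^bsub>G\<^esub> r) ` carrier G = carrier G"
    using r finite_G G.inj_on_multc[OF r]
    by (intro card_subset_eq) (auto simp: card_image)
  have "(\<Oplus>\<^bsub>A\<^esub>g\<in>(\<lambda>s. s \<otimes>\<^bsub>G\<^esub> r) ` carrier G. f g) = (\<Oplus>\<^bsub>A\<^esub>s\<in>carrier G. f (s \<otimes>\<^bsub>G\<^esub> r))"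
    using f r G.inj_on_multc[OF r] by (intro A.finsum_reindex) auto
  then show ?thesis by (simp only: img)
qed

lemma hom_component_mult:
  assumes g: "g \<in> carrier G" and r: "r \<in> carrier G" and x: "x \<in> carrier A" and y: "y \<in> gr r"
  shows "hom_component G A gr (g \<otimes>\<^bsub>G\<^esub> r) (x \<otimes>\<^bsub>A\<^esub> y) = hom_component G A gr g x \<otimes>\<^bsub>A\<^esub> y"
proof -
  let ?f = "\<lambda>k. hom_component G A gr (k \<otimes>\<^bsub>G\<^esub> inv\<^bsub>G\<^esub> r) x \<otimes>\<^bsub>A\<^esub> y"
  have yc: "y \<in> carrier A" using gr_carrier r y by blast
  have "hom_component G A gr (g \<otimes>\<^bsub>G\<^esub> r) (x \<otimes>\<^bsub>A\<^esub> y) = ?f (g \<otimes>\<^bsub>G\<^esub> r)"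
  proof (rule hom_component_unique)
    show "?f k \<in> gr k" if "k \<in> carrier G" for k
      using gr_mult[of "k \<otimes>\<^bsub>G\<^esub> inv\<^bsub>G\<^esub> r" r] that r x y hom_component_mem by (simp add: G.m_assoc)
    have "x \<otimes>\<^bsub>A\<^esub> y = (\<Oplus>\<^bsub>A\<^esub>k\<in>carrier G. hom_component G A gr k x) \<otimes>\<^bsub>A\<^esub> y"
      using hom_component_sum x by simp
    also have "\<dots> = (\<Oplus>\<^bsub>A\<^esub>k\<in>carrier G. hom_component G A gr k x \<otimes>\<^bsub>A\<^esub> y)"
      using x yc finite_G hom_component_closed by (subst A.finsum_ldistr) auto
    also have "\<dots> = (\<Oplus>\<^bsub>A\<^esub>k\<in>carrier G. ?f k)"
      using x yc r hom_component_closed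
      by (subst finsum_right_translate[OF r, of ?f]) (auto intro!: A.finsum_cong' simp: G.m_assoc)
    finally show "x \<otimes>\<^bsub>A\<^esub> y = \<dots>" .
  qed (use g r in simp)
  then show ?thesis using g r by (simp add: G.m_assoc)
qed

text \<open>
  The idempotent \<open>\<phi>\<^sub>1\<close> has counit \<open>1\<close> and projects onto the component of degree \<open>1\<close>, so invariance under
  it alone forces an element into that component.
\<close>

lemma inv_ring_eq: "inv_ring G A gr = gr \<one>\<^bsub>G\<^esub>"
proof (intro subset_antisym subsetI)
  fix x assume x: "x \<in> inv_ring G A gr"
  then have xc: "x \<in> carrier A" by (simp add: inv_ring_def)
  have "dual_idem G \<one>\<^bsub>G\<^esub> \<in> carrier (group_dual G :: ('k, 'g \<Rightarrow> 'k) module)"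
    by (auto simp: dual_idem_def group_dual_def)
  then have "dual_action G A gr (dual_idem G \<one>\<^bsub>G\<^esub>) x = dual_counit G (dual_idem G \<one>\<^bsub>G\<^esub>) \<odot>\<^bsub>A\<^esub> x"
    using x unfolding inv_ring_def by blast
  then have "hom_component G A gr \<one>\<^bsub>G\<^esub> x = x"
    unfolding dual_action_idem[OF G.one_closed xc]
    using xc by (simp add: dual_counit_def dual_idem_def smult_one)
  then show "x \<in> gr \<one>\<^bsub>G\<^esub>" using hom_component_mem[of "\<one>\<^bsub>G\<^esub>" x] xc by simp
next
  fix x assume x: "x \<in> gr \<one>\<^bsub>G\<^esub>"
  then have xc: "x \<in> carrier A" using gr_carrier by blast
  have "dual_action G A gr h x = h \<one>\<^bsub>G\<^esub> \<odot>\<^bsub>A\<^esub> x" for h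
    unfolding dual_action_def using x xc
    by (subst finsum_single[of "\<one>\<^bsub>G\<^esub>"]) (auto simp: hom_component_homogeneous[OF G.one_closed _ x] smult_closed)
  then show "x \<in> inv_ring G A gr" using xc by (simp add: inv_ring_def dual_counit_def)
qed

lemma smash_carrier_closed:
  "F \<in> carrier (smash_product G A gr) \<Longrightarrow> g \<in> carrier G \<Longrightarrow> F g \<in> carrier A"
  by (auto simp: smash_product_def)

lemma auslander_map_apply:
  assumes F: "F \<in> carrier (smash_product G A gr)" and y: "y \<in> carrier A"
  shows "auslander_map G A gr F y = (\<Oplus>\<^bsub>A\<^esub>g\<in>carrier G. F g \<otimes>\<^bsub>A\<^esub> hom_component G A gr g y)"
  unfolding auslander_map_def using y smash_carrier_closed[OF F] hom_component_closed
  by (auto simp: dual_action_idem intro!: A.finsum_cong')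

text \<open>
  On the component of degree \<open>r\<close> only the coefficient at \<open>\<phi>\<^sub>r\<close> acts.  Together with \<open>additive_eqI\<close> this
  reduces every identity between Auslander maps to one left multiplication on each component.
\<close>

lemma auslander_map_homogeneous:
  assumes F: "F \<in> carrier (smash_product G A gr)" and r: "r \<in> carrier G" and y: "y \<in> gr r"
  shows "auslander_map G A gr F y = F r \<otimes>\<^bsub>A\<^esub> y"
proof -
  have yc: "y \<in> carrier A" using gr_carrier r y by blast
  show ?thesis
    unfolding auslander_map_apply[OF F yc]
    using r y yc smash_carrier_closed[OF F]
    by (subst finsum_single[of r]) (auto simp: hom_component_homogeneous)
qed

lemma auslander_map_closed:
  assumes "F \<in> carrier (smash_product G A gr)" and "y \<in> carrier A"
  shows "auslander_map G A gr F y \<in> carrier A"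
  unfolding auslander_map_apply[OF assms]
  using smash_carrier_closed[OF assms(1)] assms(2) hom_component_closed by (auto intro!: A.finsum_closed)

lemma auslander_map_add:
  assumes F: "F \<in> carrier (smash_product G A gr)" and x: "x \<in> carrier A" and y: "y \<in> carrier A"
  shows "auslander_map G A gr F (x \<oplus>\<^bsub>A\<^esub> y) = auslander_map G A gr F x \<oplus>\<^bsub>A\<^esub> auslander_map G A gr F y"
proof -
  note cl = smash_carrier_closed[OF F] hom_component_closed
  have "auslander_map G A gr F (x \<oplus>\<^bsub>A\<^esub> y) = (\<Oplus>\<^bsub>A\<^esub>g\<in>carrier G.
      F g \<otimes>\<^bsub>A\<^esub> hom_component G A gr g x \<oplus>\<^bsub>A\<^esub> F g \<otimes>\<^bsub>A\<^esub> hom_component G A gr g y)"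
    unfolding auslander_map_apply[OF F A.a_closed[OF x y]] using x y cl
    by (intro A.finsum_cong') (auto simp: hom_component_add A.r_distr)
  also have "\<dots> = auslander_map G A gr F x \<oplus>\<^bsub>A\<^esub> auslander_map G A gr F y"
    unfolding auslander_map_apply[OF F x] auslander_map_apply[OF F y] using x y cl
    by (intro A.finsum_addf) auto
  finally show ?thesis .
qed

lemma additive_eqI:
  assumes p: "\<And>x. x \<in> carrier A \<Longrightarrow> p x \<in> carrier A"
    and q: "\<And>x. x \<in> carrier A \<Longrightarrow> q x \<in> carrier A"
    and padd: "\<And>x y. x \<in> carrier A \<Longrightarrow> y \<in> carrier A \<Longrightarrow> p (x \<oplus>\<^bsub>A\<^esub> y) = p x \<oplus>\<^bsub>A\<^esub> p y"
    and qadd: "\<And>x y. x \<in> carrier A \<Longrightarrow> y \<in> carrier A \<Longrightarrow> q (x \<oplus>\<^bsub>A\<^esub> y) = q x \<oplus>\<^bsub>A\<^esub> q y"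
    and eq: "\<And>r y. r \<in> carrier G \<Longrightarrow> y \<in> gr r \<Longrightarrow> p y = q y"
    and x: "x \<in> carrier A"
  shows "p x = q x"
proof -
  have zero: "t \<zero>\<^bsub>A\<^esub> = \<zero>\<^bsub>A\<^esub>"
    if "\<And>x. x \<in> carrier A \<Longrightarrow> t x \<in> carrier A"
      "\<And>x y. x \<in> carrier A \<Longrightarrow> y \<in> carrier A \<Longrightarrow> t (x \<oplus>\<^bsub>A\<^esub> y) = t x \<oplus>\<^bsub>A\<^esub> t y" for t
    using that(1)[of "\<zero>\<^bsub>A\<^esub>"] that(2)[of "\<zero>\<^bsub>A\<^esub>" "\<zero>\<^bsub>A\<^esub>"] A.add.r_cancel_one' by force
  have "p (\<Oplus>\<^bsub>A\<^esub>g\<in>S. f g) = q (\<Oplus>\<^bsub>A\<^esub>g\<in>S. f g)"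
    if "finite S" "S \<subseteq> carrier G" "\<And>g. g \<in> S \<Longrightarrow> f g \<in> gr g" for S f
    using that
  proof (induction S rule: finite_induct)
    case empty
    then show ?case using zero[OF p padd] zero[OF q qadd] by simp
  next
    case (insert g S)
    have "f g \<in> carrier A" "f \<in> S \<rightarrow> carrier A" using insert.prems gr_carrier by blast+
    then show ?case using insert padd qadd eq[of g "f g"] by (simp add: A.finsum_closed)
  qed
  from this[OF finite_G subset_refl, of "\<lambda>g. hom_component G A gr g x"]
  show ?thesis using hom_component_sum[OF x] hom_component_mem x by simp
qed

lemma auslander_map_mem:
  assumes F: "F \<in> carrier (smash_product G A gr)"
  shows "auslander_map G A gr F \<in> carrier (right_End A (inv_ring G A gr))"
proof -
  have "auslander_map G A gr F (x \<otimes>\<^bsub>A\<^esub> r) = auslander_map G A gr F x \<otimes>\<^bsub>A\<^esub> r"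
    if x: "x \<in> carrier A" and r: "r \<in> gr \<one>\<^bsub>G\<^esub>" for x r
  proof -
    have rc: "r \<in> carrier A" using r gr_carrier by blast
    have "auslander_map G A gr F (x \<otimes>\<^bsub>A\<^esub> r)
        = (\<Oplus>\<^bsub>A\<^esub>g\<in>carrier G. (F g \<otimes>\<^bsub>A\<^esub> hom_component G A gr g x) \<otimes>\<^bsub>A\<^esub> r)"
      using x rc smash_carrier_closed[OF F] hom_component_closed hom_component_mult[OF _ _ x r]
      by (auto simp: auslander_map_apply[OF F] A.m_assoc intro!: A.finsum_cong')
    also have "\<dots> = auslander_map G A gr F x \<otimes>\<^bsub>A\<^esub> r"
      using x rc smash_carrier_closed[OF F] hom_component_closed finite_G
      by (subst A.finsum_ldistr[symmetric]) (auto simp: auslander_map_apply[OF F])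
    finally show ?thesis .
  qed
  then show ?thesis
    using auslander_map_add[OF F] auslander_map_closed[OF F]
    by (auto simp: right_End_def inv_ring_eq auslander_map_def)
qed

text \<open>
  For empty \<open>B\<close> this is a statement about additive maps; in this form it identifies the Auslander maps
  of products and sums.
\<close>

lemma auslander_map_eqI:
  assumes F: "F \<in> carrier (smash_product G A gr)" and f: "f \<in> carrier (right_End A B)"
    and eq: "\<And>r y. r \<in> carrier G \<Longrightarrow> y \<in> gr r \<Longrightarrow> f y = F r \<otimes>\<^bsub>A\<^esub> y"
  shows "auslander_map G A gr F = f"
proof (rule extensionalityI)
  show "auslander_map G A gr F \<in> extensional (carrier A)" by (simp add: auslander_map_def)
  show "f \<in> extensional (carrier A)" using f by (auto simp: right_End_def PiE_def)
  show "auslander_map G A gr F x = f x" if "x \<in> carrier A" for x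
    by (rule additive_eqI[OF auslander_map_closed[OF F] _ auslander_map_add[OF F] _ _ that])
      (use f in \<open>auto simp: right_End_def eq auslander_map_homogeneous[OF F]\<close>)
qed

lemma smash_mult_closed:
  assumes F: "F \<in> carrier (smash_product G A gr)" and F': "F' \<in> carrier (smash_product G A gr)"
  shows "smash_mult G A gr F F' \<in> carrier (smash_product G A gr)"
proof -
  note cl = smash_carrier_closed[OF F] smash_carrier_closed[OF F'] hom_component_closed
  have "smash_mult G A gr F F' r \<in> carrier A" if "r \<in> carrier G" for r
    using that cl by (subst smash_mult_eq) (auto intro!: A.finsum_closed)
  moreover have "smash_mult G A gr F F' \<in> extensional (carrier G)"
    unfolding smash_mult_def by (rule restrict_extensional)
  ultimately show ?thesis by (auto simp: smash_product_def PiE_iff)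
qed

lemma auslander_map_smash_mult:
  assumes F: "F \<in> carrier (smash_product G A gr)" and F': "F' \<in> carrier (smash_product G A gr)"
  shows "auslander_map G A gr (smash_mult G A gr F F')
    = compose (carrier A) (auslander_map G A gr F) (auslander_map G A gr F')"
proof (rule auslander_map_eqI[OF smash_mult_closed[OF F F']])
  note cl = smash_carrier_closed[OF F] smash_carrier_closed[OF F'] hom_component_closed
  have [simp]: "auslander_map G A gr F x \<in> carrier A" "auslander_map G A gr F' x \<in> carrier A"
    if "x \<in> carrier A" for x
    using that auslander_map_closed F F' by auto
  show "compose (carrier A) (auslander_map G A gr F) (auslander_map G A gr F') \<in> carrier (right_End A {})"
    using auslander_map_add[OF F] auslander_map_add[OF F']
    by (auto simp: right_End_def compose_def)
  fix r y assume r: "r \<in> carrier G" and y: "y \<in> gr r"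
  then have yc: "y \<in> carrier A" using gr_carrier by blast
  have "auslander_map G A gr F (F' r \<otimes>\<^bsub>A\<^esub> y)
      = (\<Oplus>\<^bsub>A\<^esub>s\<in>carrier G. F (s \<otimes>\<^bsub>G\<^esub> r) \<otimes>\<^bsub>A\<^esub> hom_component G A gr (s \<otimes>\<^bsub>G\<^esub> r) (F' r \<otimes>\<^bsub>A\<^esub> y))"
    using r yc cl by (subst finsum_right_translate[OF r, symmetric]) (auto simp: auslander_map_apply[OF F])
  also have "\<dots> = (\<Oplus>\<^bsub>A\<^esub>s\<in>carrier G. (F (s \<otimes>\<^bsub>G\<^esub> r) \<otimes>\<^bsub>A\<^esub> hom_component G A gr s (F' r)) \<otimes>\<^bsub>A\<^esub> y)"
    using r y yc cl by (auto simp: hom_component_mult A.m_assoc intro!: A.finsum_cong')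
  also have "\<dots> = smash_mult G A gr F F' r \<otimes>\<^bsub>A\<^esub> y"
    using r yc cl finite_G
    by (subst smash_mult_eq) (auto simp: A.finsum_ldistr)
  finally show "compose (carrier A) (auslander_map G A gr F) (auslander_map G A gr F') y
      = smash_mult G A gr F F' r \<otimes>\<^bsub>A\<^esub> y"
    using yc by (simp add: compose_def auslander_map_homogeneous[OF F' r y])
qed

text \<open>
  Only bijectivity of the Auslander map can fail, and only that has to be examined for a specific
  grading.
\<close>

lemma auslander_map_ring_hom:
  "auslander_map G A gr \<in> ring_hom (smash_product G A gr) (right_End A (inv_ring G A gr))"
proof (rule ring_hom_memI)
  fix F F' assume F: "F \<in> carrier (smash_product G A gr)" and F': "F' \<in> carrier (smash_product G A gr)"
  note cl = smash_carrier_closed[OF F] smash_carrier_closed[OF F'] hom_component_closed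
  show "auslander_map G A gr F \<in> carrier (right_End A (inv_ring G A gr))"
    by (rule auslander_map_mem[OF F])
  show "auslander_map G A gr (F \<otimes>\<^bsub>smash_product G A gr\<^esub> F') =
      auslander_map G A gr F \<otimes>\<^bsub>right_End A (inv_ring G A gr)\<^esub> auslander_map G A gr F'"
    using auslander_map_smash_mult[OF F F'] by (simp add: smash_product_def right_End_def)
  have sum: "F \<oplus>\<^bsub>smash_product G A gr\<^esub> F' = (\<lambda>g\<in>carrier G. F g \<oplus>\<^bsub>A\<^esub> F' g)"
    by (simp add: smash_product_def)
  then have S: "F \<oplus>\<^bsub>smash_product G A gr\<^esub> F' \<in> carrier (smash_product G A gr)"
    using cl by (auto simp: smash_product_def)
  show "auslander_map G A gr (F \<oplus>\<^bsub>smash_product G A gr\<^esub> F') =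
      auslander_map G A gr F \<oplus>\<^bsub>right_End A (inv_ring G A gr)\<^esub> auslander_map G A gr F'"
  proof (rule auslander_map_eqI[OF S])
    show "auslander_map G A gr F \<oplus>\<^bsub>right_End A (inv_ring G A gr)\<^esub> auslander_map G A gr F'
        \<in> carrier (right_End A {})"
      using auslander_map_add[OF F] auslander_map_add[OF F'] auslander_map_closed[OF F] auslander_map_closed[OF F']
      by (auto simp: right_End_def A.a_ac)
    fix r y assume r: "r \<in> carrier G" and y: "y \<in> gr r"
    then have "y \<in> carrier A" using gr_carrier by blast
    then show "(auslander_map G A gr F \<oplus>\<^bsub>right_End A (inv_ring G A gr)\<^esub> auslander_map G A gr F') y =
        (F \<oplus>\<^bsub>smash_product G A gr\<^esub> F') r \<otimes>\<^bsub>A\<^esub> y"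
      using r y cl by (simp add: sum right_End_def auslander_map_homogeneous[OF F] auslander_map_homogeneous[OF F'] A.l_distr)
  qed
next
  have one: "\<one>\<^bsub>smash_product G A gr\<^esub> = (\<lambda>g\<in>carrier G. \<one>\<^bsub>A\<^esub>)"
    by (auto simp: smash_product_def smash_tensor_def group_dual_def smult_one)
  show "auslander_map G A gr \<one>\<^bsub>smash_product G A gr\<^esub> = \<one>\<^bsub>right_End A (inv_ring G A gr)\<^esub>"
  proof (rule auslander_map_eqI)
    show "\<one>\<^bsub>smash_product G A gr\<^esub> \<in> carrier (smash_product G A gr)"
      unfolding one by (auto simp: smash_product_def)
    show "\<one>\<^bsub>right_End A (inv_ring G A gr)\<^esub> \<in> carrier (right_End A {})"
      by (auto simp: right_End_def)
    fix r y assume "r \<in> carrier G" "y \<in> gr r"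
    then show "\<one>\<^bsub>right_End A (inv_ring G A gr)\<^esub> y = \<one>\<^bsub>smash_product G A gr\<^esub> r \<otimes>\<^bsub>A\<^esub> y"
      using gr_carrier by (auto simp: one right_End_def)
  qed
qed

end

section \<open>Push-forward of finitely supported functions\<close>

lemma poly_mapping_add_induct [case_names zero single add]:
  assumes zero: "P 0"
    and single: "\<And>x c. P (Poly_Mapping.single x c)"
    and add: "\<And>p q. P p \<Longrightarrow> P q \<Longrightarrow> P (p + q)"
  shows "P (p :: 'a \<Rightarrow>\<^sub>0 'k::comm_monoid_add)"
proof -
  have "P (\<Sum>x\<in>S. Poly_Mapping.single x (Poly_Mapping.lookup p x))" if "finite S" for S
    using that by (induction S rule: finite_induct) (auto intro: assms)
  moreover have "p = (\<Sum>x\<in>Poly_Mapping.keys p. Poly_Mapping.single x (Poly_Mapping.lookup p x))"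
    by (rule poly_mapping_eqI) (auto simp: lookup_sum lookup_single when_def in_keys_iff)
  ultimately show ?thesis by (metis finite_keys)
qed

text \<open>
  For a monoid homomorphism \<open>h\<close> this is the induced map of monoid algebras.
\<close>

definition push_forward :: "('a \<Rightarrow> 'b) \<Rightarrow> ('a \<Rightarrow>\<^sub>0 'k::comm_monoid_add) \<Rightarrow> ('b \<Rightarrow>\<^sub>0 'k)" where
  "push_forward h p = (\<Sum>x\<in>Poly_Mapping.keys p. Poly_Mapping.single (h x) (Poly_Mapping.lookup p x))"

lemma push_forward_eq_sum:
  assumes "finite S" "Poly_Mapping.keys p \<subseteq> S"
  shows "push_forward h p = (\<Sum>x\<in>S. Poly_Mapping.single (h x) (Poly_Mapping.lookup p x))"
  unfolding push_forward_def using assms by (intro sum.mono_neutral_left) (auto simp: in_keys_iff)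

lemma push_forward_zero [simp]: "push_forward h 0 = 0"
  by (simp add: push_forward_def)

lemma push_forward_add: "push_forward h (p + q) = push_forward h p + push_forward h q"
proof -
  let ?S = "Poly_Mapping.keys p \<union> Poly_Mapping.keys q"
  have sums: "push_forward h r = (\<Sum>x\<in>?S. Poly_Mapping.single (h x) (Poly_Mapping.lookup r x))"
    if "Poly_Mapping.keys r \<subseteq> ?S" for r
    using that by (intro push_forward_eq_sum) auto
  show ?thesis
    unfolding sums[OF Poly_Mapping.keys_add] sums[OF Un_upper1] sums[OF Un_upper2]
    by (simp add: lookup_add single_add sum.distrib)
qed

lemma push_forward_single [simp]: "push_forward h (Poly_Mapping.single x c) = Poly_Mapping.single (h x) c"
  by (simp add: push_forward_def)

lemma push_forward_uminus: "push_forward h (- p) = - push_forward h (p :: 'a \<Rightarrow>\<^sub>0 'k::ab_group_add)"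
  using push_forward_add[of h p "- p"] by (simp add: eq_neg_iff_add_eq_0 add.commute)

lemma push_forward_minus: "push_forward h (p - q) = push_forward h p - push_forward h (q :: 'a \<Rightarrow>\<^sub>0 'k::ab_group_add)"
  using push_forward_add[of h p "- q"] by (simp add: push_forward_uminus)

lemma push_forward_push_forward: "push_forward h (push_forward k p) = push_forward (\<lambda>x. h (k x)) p"
  by (induction p rule: poly_mapping_add_induct) (simp_all add: push_forward_add)

lemma push_forward_cong_id: "(\<And>x. x \<in> Poly_Mapping.keys p \<Longrightarrow> h x = x) \<Longrightarrow> push_forward h p = p"
  by (rule poly_mapping_eqI) (auto simp: push_forward_def lookup_sum lookup_single when_def in_keys_iff)

lemma keys_push_forward: "Poly_Mapping.keys (push_forward h p) \<subseteq> h ` Poly_Mapping.keys p"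
  using Poly_Mapping.keys_sum[of "\<lambda>x. Poly_Mapping.single (h x) (Poly_Mapping.lookup p x)"]
  unfolding push_forward_def by (fastforce split: if_splits)

lemma push_forward_mult:
  fixes p q :: "'a::monoid_add \<Rightarrow>\<^sub>0 'k::semiring_0" and h :: "'a \<Rightarrow> 'b::monoid_add"
  assumes h: "\<And>x y. h (x + y) = h x + h y"
  shows "push_forward h (p * q) = push_forward h p * push_forward h q"
proof (induction p rule: poly_mapping_add_induct)
  case (single x c)
  show ?case
    by (induction q rule: poly_mapping_add_induct) (simp_all add: push_forward_add distrib_left mult_single h)
qed (simp_all add: push_forward_add distrib_right)

section \<open>The Klein bottle group and weights of words\<close>

text \<open>
  The Klein bottle group, as the semidirect product in which the generator of the second factor
  acts on the first one by negation.  It is generated by \<open>u = (0, 1)\<close> and \<open>v = (-1, 1)\<close> with \<open>u + u = v + v = (0, 2)\<close>, a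
  central element.  The group is written additively so that the convolution product of finitely
  supported functions becomes the group algebra.
\<close>

datatype klein = Klein (rot: int) (len: int)

instantiation klein :: group_add
begin
definition zero_klein :: klein where "0 = Klein 0 0"
definition plus_klein :: "klein \<Rightarrow> klein \<Rightarrow> klein"
  where "x + y = Klein (rot x + (if even (len x) then rot y else - rot y)) (len x + len y)"
definition uminus_klein :: "klein \<Rightarrow> klein"
  where "- x = Klein (if even (len x) then - rot x else rot x) (- len x)"
definition minus_klein :: "klein \<Rightarrow> klein \<Rightarrow> klein" where "x - y = x + - (y :: klein)"
instance
  by standard (auto simp: zero_klein_def plus_klein_def uminus_klein_def minus_klein_def klein.expand)
end

lemma klein_simps [simp]:
  "rot 0 = 0" "len 0 = 0"
  "rot (x + y) = rot x + (if even (len x) then rot y else - rot y)" "len (x + y) = len x + len y"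
  "rot (- x) = (if even (len x) then - rot x else rot x)" "len (- x) = - len x"
  by (simp_all add: zero_klein_def plus_klein_def uminus_klein_def)

text \<open>
  The submonoid generated by \<open>u\<close> and \<open>v\<close>.  A letter \<open>v\<close> at position \<open>p\<close> of a word, counted from \<open>0\<close>,
  contributes \<open>-(-1)\<^sup>p\<close> to the first coordinate, so for words of length \<open>n\<close> this coordinate is bounded
  below by minus the number of even positions and above by the number of odd ones.
\<close>

definition klein_monoid :: "klein set" where
  "klein_monoid = {x. - ((len x + 1) div 2) \<le> rot x \<and> rot x \<le> len x div 2}"

primrec letter_weight :: "uv \<Rightarrow> klein" where
  "letter_weight Gen_u = Klein 0 1"
| "letter_weight Gen_v = Klein (- 1) 1"

definition weight :: "uv free_word \<Rightarrow> klein" where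
  "weight w = sum_list (map letter_weight (letters w))"

lemma weight_plus: "weight (v + w) = weight v + weight w"
  by (simp add: weight_def plus_free_word_def)

lemma weight_Cons: "weight (Word (x # xs)) = letter_weight x + weight (Word xs)"
  by (simp add: weight_def)

lemma weight_Nil: "weight (Word []) = 0"
  by (simp add: weight_def)

lemma len_weight: "len (weight (Word xs)) = int (length xs)"
proof (induction xs)
  case (Cons x xs)
  then show ?case by (cases x) (simp_all add: weight_Cons)
qed (simp add: weight_Nil)

lemma weight_mem: "weight w \<in> klein_monoid"
proof -
  have "weight (Word xs) \<in> klein_monoid" for xs
  proof (induction xs)
    case (Cons x xs)
    then show ?case by (cases x) (simp_all add: weight_Cons klein_monoid_def, presburger+)
  qed (simp add: weight_Nil klein_monoid_def)
  then show ?thesis by (cases w) simp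
qed

lemma klein_monoid_len: "x \<in> klein_monoid \<Longrightarrow> 0 \<le> len x"
  unfolding klein_monoid_def by simp presburger

lemma weight_surj:
  assumes "x \<in> klein_monoid"
  shows "\<exists>w. weight w = x"
proof -
  have "x \<in> klein_monoid \<Longrightarrow> len x = int n \<Longrightarrow> \<exists>xs. weight (Word xs) = x" for n x
  proof (induction n arbitrary: x)
    case 0
    then have "x = 0" by (auto simp: klein_monoid_def intro!: klein.expand)
    then show ?case using weight_Nil by blast
  next
    case (Suc n)
    let ?y = "Klein (- rot x) (int n)" and ?z = "Klein (- 1 - rot x) (int n)"
    have y: "letter_weight Gen_u + ?y = x" and z: "letter_weight Gen_v + ?z = x"
      using Suc.prems(2) by (auto intro!: klein.expand)
    have "?y \<in> klein_monoid \<or> ?z \<in> klein_monoid"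
      using Suc.prems unfolding klein_monoid_def by simp presburger
    then show ?case
    proof
      assume "?y \<in> klein_monoid"
      then obtain xs where "weight (Word xs) = ?y" using Suc.IH[of ?y] by auto
      then show ?thesis using y weight_Cons by metis
    next
      assume "?z \<in> klein_monoid"
      then obtain xs where "weight (Word xs) = ?z" using Suc.IH[of ?z] by auto
      then show ?thesis using z weight_Cons by metis
    qed
  qed
  from this[OF assms, of "nat (len x)"] klein_monoid_len[OF assms] show ?thesis by auto
qed

text \<open>
  The relations between words with the same weight all follow from \<open>uu = vv\<close>, that is, the monoid
  presented by this relation embeds into the group.  If both words start with the same letter, it
  can be cancelled.  If they are \<open>u p\<close> and \<open>v q\<close>, then the bounds on the weights of \<open>p\<close> and \<open>q\<close> leave room
  for a word \<open>r\<close> with \<open>p\<close> equivalent to \<open>u r\<close> and \<open>q\<close> equivalent to \<open>v r\<close>, and \<open>uur\<close> is linked to \<open>vvr\<close>.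
\<close>

lemma weight_eq_induct [consumes 1, case_names refl sym trans Cons square]:
  assumes weight: "weight (Word xs) = weight (Word ys)"
    and refl: "\<And>xs. P xs xs"
    and sym: "\<And>xs ys. P xs ys \<Longrightarrow> P ys xs"
    and trans: "\<And>xs ys zs. P xs ys \<Longrightarrow> P ys zs \<Longrightarrow> P xs zs"
    and Cons: "\<And>x xs ys. P xs ys \<Longrightarrow> P (x # xs) (x # ys)"
    and square: "\<And>xs. P (Gen_u # Gen_u # xs) (Gen_v # Gen_v # xs)"
  shows "P xs ys"
proof -
  have "P xs ys"
    if "weight (Word xs) = weight (Word ys)" "length xs = n" "length ys = n" for n xs ys
    using that
  proof (induction n arbitrary: xs ys)
    case 0
    then show ?case using refl by simp
  next
    case (Suc n)
    have mixed: "P (Gen_u # p) (Gen_v # q)"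
      if w: "weight (Word (Gen_u # p)) = weight (Word (Gen_v # q))" and len: "length p = n" "length q = n"
      for p q
    proof -
      \<comment> \<open>The weight of \<open>r\<close>, obtained by cancelling \<open>u\<close> from that of \<open>p\<close>.\<close>
      let ?y = "Klein (- rot (weight (Word p))) (int n - 1)"
      have rot: "rot (weight (Word q)) = rot (weight (Word p)) - 1"
        using arg_cong[OF w, of rot] by (simp add: weight_Cons)
      have "?y \<in> klein_monoid"
        using weight_mem[of "Word p"] weight_mem[of "Word q"] len
        unfolding klein_monoid_def by (simp add: rot len_weight)
      then obtain r where r: "weight (Word r) = ?y"
        using weight_surj by (metis free_word.exhaust)
      have "len (weight (Word r)) = int n - 1" using r by simp
      then have rl: "length r + 1 = n" by (simp add: len_weight)
      have "weight (Word p) = weight (Word (Gen_u # r))" "weight (Word (Gen_v # r)) = weight (Word q)"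
        unfolding weight_Cons r using len rot by (auto intro!: klein.expand simp: len_weight)
      then have "P p (Gen_u # r)" "P (Gen_v # r) q"
        using Suc.IH len rl by auto
      then show ?thesis using Cons square trans by blast
    qed
    obtain x p where xs: "xs = x # p" "length p = n" using Suc.prems(2) by (cases xs) auto
    obtain y q where ys: "ys = y # q" "length q = n" using Suc.prems(3) by (cases ys) auto
    show ?case
    proof (cases "x = y")
      case True
      then have "weight (Word p) = weight (Word q)" using Suc.prems(1) xs ys by (simp add: weight_Cons)
      then show ?thesis using Suc.IH[OF _ xs(2) ys(2)] Cons xs(1) ys(1) True by simp
    next
      case False
      then consider "x = Gen_u" "y = Gen_v" | "x = Gen_v" "y = Gen_u"
        by (cases x; cases y) auto
      then show ?thesis
        using mixed[of p q] mixed[of q p] sym Suc.prems(1) xs ys by cases auto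
    qed
  qed
  moreover have "length xs = length ys" using weight len_weight by (metis of_nat_eq_iff)
  ultimately show ?thesis using weight by blast
qed

definition word_of :: "klein \<Rightarrow> uv free_word" where
  "word_of x = (SOME w. weight w = x)"

lemma weight_word_of: "x \<in> klein_monoid \<Longrightarrow> weight (word_of x) = x"
  unfolding word_of_def using weight_surj by (rule someI_ex)

section \<open>The algebra inside a group algebra\<close>

text \<open>
  The weights of \<open>uu\<close> and \<open>vv\<close> agree, so taking weights descends to a homomorphism from \<open>A\<close> to the
  group algebra of the Klein bottle group.
\<close>

lemma push_forward_weight_uv_ideal:
  fixes p :: "(uv, 'k::field) free_alg_elem"
  assumes "p \<in> uv_ideal"
  shows "push_forward weight p = 0"
proof -
  let ?J = "{p :: (uv, 'k) free_alg_elem. push_forward weight p = 0}"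
  interpret F: ring "free_algebra :: ('k, (uv, 'k) free_alg_elem) module"
    by (rule ring_free_algebra)
  have "ideal ?J free_algebra"
  proof (rule idealI[OF ring_free_algebra])
    show "subgroup ?J (add_monoid free_algebra)"
    proof (rule group.subgroupI[OF F.a_group])
      fix p q :: "(uv, 'k) free_alg_elem" assume p: "p \<in> ?J"
      have "inv\<^bsub>add_monoid free_algebra\<^esub> p = - p" using a_inv_free_algebra[of p] by (simp add: a_inv_def)
      then show "inv\<^bsub>add_monoid free_algebra\<^esub> p \<in> ?J"
        using p by (simp add: push_forward_uminus)
      assume "q \<in> ?J"
      then show "p \<otimes>\<^bsub>add_monoid free_algebra\<^esub> q \<in> ?J"
        using p by (simp add: push_forward_add)
    qed (auto intro: exI[of _ 0])
  qed (simp_all add: push_forward_mult weight_plus)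
  moreover have "free_gen Gen_u * free_gen Gen_u - free_gen Gen_v * free_gen Gen_v \<in> ?J"
    by (simp add: push_forward_minus free_gen_def mult_single weight_plus weight_Cons weight_Nil plus_klein_def)
  ultimately have "uv_ideal \<subseteq> ?J"
    unfolding uv_ideal_def[where 'k='k] by (intro F.genideal_minimal) auto
  then show ?thesis using assms by blast
qed

lemma single_diff_uv_ideal:
  assumes "weight v = weight w"
  shows "Poly_Mapping.single v c - Poly_Mapping.single w c \<in> (uv_ideal :: (uv, 'k::field) free_alg_elem set)"
proof -
  obtain xs ys where vw: "v = Word xs" "w = Word ys" by (cases v; cases w)
  have "Poly_Mapping.single (Word xs) 1 - Poly_Mapping.single (Word ys) 1 \<in> (uv_ideal :: (uv, 'k) free_alg_elem set)"
    using assms[unfolded vw]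
  proof (induction rule: weight_eq_induct)
    case (sym xs ys)
    then show ?case using uv_ideal_closed(3) by fastforce
  next
    case (trans xs ys zs)
    then show ?case using uv_ideal_closed(2) by fastforce
  next
    case (Cons x xs ys)
    then have "Poly_Mapping.single (Word [x]) 1 *
        (Poly_Mapping.single (Word xs) 1 - Poly_Mapping.single (Word ys) 1) \<in> (uv_ideal :: (uv, 'k) free_alg_elem set)"
      by (rule uv_ideal_closed(4))
    then show ?case by (simp add: right_diff_distrib mult_single plus_free_word_def)
  next
    case (square xs)
    have "free_gen Gen_u * free_gen Gen_u - free_gen Gen_v * free_gen Gen_v \<in> (uv_ideal :: (uv, 'k) free_alg_elem set)"
      unfolding uv_ideal_def by (rule ring.genideal_self'[OF ring_free_algebra]) simp
    from uv_ideal_closed(5)[OF this, of "Poly_Mapping.single (Word xs) 1"]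
    show ?case by (simp add: left_diff_distrib mult_single plus_free_word_def free_gen_def)
  qed (simp add: uv_ideal_closed(1))
  from uv_ideal_closed(4)[OF this, of "Poly_Mapping.single 0 c"]
  show ?thesis by (simp add: vw right_diff_distrib mult_single)
qed

text \<open>
  Modulo the ideal each word can be replaced by the chosen word of the same weight, so an element of \<open>A\<close>
  is determined by its image in the group algebra.
\<close>

lemma uv_class_push_forward_word_of: "uv_class (push_forward word_of (push_forward weight p)) = uv_class (p :: (uv, 'k::field) free_alg_elem)"
proof -
  have "push_forward word_of (push_forward weight p) - p \<in> uv_ideal"
  proof (induction p rule: poly_mapping_add_induct)
    case (single w c)
    show ?case by (simp add: single_diff_uv_ideal weight_word_of weight_mem)
  next
    case (add p q)
    from uv_ideal_closed(2)[OF add.IH] show ?case by (simp add: push_forward_add add_diff_add)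
  qed (simp add: uv_ideal_closed(1))
  then show ?thesis by (simp add: uv_class_eq_iff)
qed

lemma uv_class_eq_iff_push_forward_weight:
  "uv_class p = uv_class q \<longleftrightarrow> push_forward weight p = push_forward weight (q :: (uv, 'k::field) free_alg_elem)"
proof
  assume "uv_class p = uv_class q"
  then show "push_forward weight p = push_forward weight q"
    using push_forward_weight_uv_ideal[of "p - q"] by (simp add: uv_class_eq_iff push_forward_minus)
next
  assume "push_forward weight p = push_forward weight q"
  then show "uv_class p = uv_class q" by (metis uv_class_push_forward_word_of)
qed

definition klein_embed :: "(uv, 'k::field) free_alg_elem set \<Rightarrow> (klein \<Rightarrow>\<^sub>0 'k)" where
  "klein_embed x = push_forward weight (SOME p. x = uv_class p)"

text \<open>
  The inverse of \<open>klein_embed\<close> on elements supported on \<open>klein_monoid\<close>; elsewhere the words chosen by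
  \<open>word_of\<close> have no meaning.
\<close>

definition of_klein :: "(klein \<Rightarrow>\<^sub>0 'k::field) \<Rightarrow> (uv, 'k) free_alg_elem set" where
  "of_klein P = uv_class (push_forward word_of P)"

lemma klein_embed_class: "klein_embed (uv_class p) = push_forward weight p"
  unfolding klein_embed_def using uv_class_eq_iff_push_forward_weight by (metis (mono_tags, lifting) someI)

lemma of_klein_closed: "of_klein P \<in> carrier uv_algebra"
  by (simp add: of_klein_def carrier_uv_algebra)

lemma klein_embed_of_klein: "Poly_Mapping.keys P \<subseteq> klein_monoid \<Longrightarrow> klein_embed (of_klein P) = P"
  unfolding of_klein_def klein_embed_class push_forward_push_forward
  by (rule push_forward_cong_id) (use weight_word_of in blast)

lemma of_klein_klein_embed: "x \<in> carrier uv_algebra \<Longrightarrow> of_klein (klein_embed x) = x"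
  by (auto simp: carrier_uv_algebra klein_embed_class of_klein_def uv_class_push_forward_word_of)

lemma klein_embed_inj:
  "x \<in> carrier uv_algebra \<Longrightarrow> y \<in> carrier uv_algebra \<Longrightarrow> klein_embed x = klein_embed y \<longleftrightarrow> x = y"
  by (metis of_klein_klein_embed)

lemma keys_klein_embed: "x \<in> carrier uv_algebra \<Longrightarrow> Poly_Mapping.keys (klein_embed x) \<subseteq> klein_monoid"
  using keys_push_forward weight_mem by (fastforce simp: carrier_uv_algebra klein_embed_class)

lemma klein_embed_add:
  "x \<in> carrier uv_algebra \<Longrightarrow> y \<in> carrier uv_algebra \<Longrightarrow>
    klein_embed (x \<oplus>\<^bsub>uv_algebra\<^esub> y) = klein_embed x + klein_embed y"
  by (auto simp: carrier_uv_algebra uv_algebra_simps klein_embed_class push_forward_add)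

lemma klein_embed_mult:
  "x \<in> carrier uv_algebra \<Longrightarrow> y \<in> carrier uv_algebra \<Longrightarrow>
    klein_embed (x \<otimes>\<^bsub>uv_algebra\<^esub> y) = klein_embed x * klein_embed y"
  by (auto simp: carrier_uv_algebra uv_algebra_simps klein_embed_class push_forward_mult weight_plus)

lemma of_klein_add: "of_klein (P + Q) = of_klein P \<oplus>\<^bsub>uv_algebra\<^esub> of_klein Q"
  by (simp add: of_klein_def push_forward_add uv_algebra_simps)

lemma mult_single_right_cancel:
  fixes p q :: "'a::group_add \<Rightarrow>\<^sub>0 'k::semiring_1"
  assumes "p * Poly_Mapping.single m 1 = q * Poly_Mapping.single m 1"
  shows "p = q"
proof -
  have *: "r * Poly_Mapping.single m 1 * Poly_Mapping.single (- m) 1 = r" for r :: "'a \<Rightarrow>\<^sub>0 'k"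
    by (simp add: mult.assoc mult_single)
  show ?thesis by (subst (1 2) *[symmetric]) (simp only: assms)
qed

lemma lookup_mult_single_add:
  fixes p :: "'a::group_add \<Rightarrow>\<^sub>0 'k::semiring_1"
  shows "Poly_Mapping.lookup (p * Poly_Mapping.single m 1) (x + m) = Poly_Mapping.lookup p x"
  by (induction p rule: poly_mapping_add_induct)
    (simp_all add: mult_single lookup_single distrib_right lookup_add when_def)

lemma klein_monoid_add:
  assumes "x \<in> klein_monoid" "y \<in> klein_monoid"
  shows "x + y \<in> klein_monoid"
proof -
  obtain v w where "weight v = x" "weight w = y" using assms weight_surj by blast
  then show ?thesis using weight_mem[of "v + w"] by (simp add: weight_plus)
qed

lemma klein_embed_single:
  "m \<in> klein_monoid \<Longrightarrow> klein_embed (of_klein (Poly_Mapping.single m c)) = Poly_Mapping.single m c"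
  by (rule klein_embed_of_klein) simp

lemma of_klein_mult_single:
  assumes "m \<in> klein_monoid" "n \<in> klein_monoid" "m + n \<in> klein_monoid"
  shows "of_klein (Poly_Mapping.single m c) \<otimes>\<^bsub>uv_algebra\<^esub> of_klein (Poly_Mapping.single n d)
    = of_klein (Poly_Mapping.single (m + n) (c * d))"
proof -
  interpret A: ring "uv_algebra :: ('a, (uv, 'a) free_alg_elem set) module" by (rule ring_uv_algebra)
  show ?thesis
    by (subst klein_embed_inj[symmetric])
      (use assms in \<open>simp_all add: of_klein_closed klein_embed_mult klein_embed_single mult_single\<close>)
qed

section \<open>Cyclic subgroups of index two\<close>

context group
begin

text \<open>
  This covers both conjugation and commutation with integer powers: \<open>y\<close> is the conjugate of \<open>x\<close> by \<open>u\<close>.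
\<close>

lemma int_pow_intertwine:
  assumes eq: "u \<otimes> x = y \<otimes> u" and c: "u \<in> carrier G" "x \<in> carrier G" "y \<in> carrier G"
  shows "u \<otimes> x [^] (i::int) = y [^] i \<otimes> u"
proof -
  have nat: "u \<otimes> x [^] (n::nat) = y [^] n \<otimes> u" for n
  proof (induction n)
    case (Suc n)
    have "u \<otimes> x [^] Suc n = (u \<otimes> x [^] n) \<otimes> x" using c by (simp add: m_assoc)
    also have "\<dots> = y [^] n \<otimes> (u \<otimes> x)" unfolding Suc.IH using c by (simp add: m_assoc)
    also have "\<dots> = y [^] Suc n \<otimes> u" unfolding eq using c by (simp add: m_assoc)
    finally show ?case .
  qed (use c in simp)
  show ?thesis
  proof (cases i)
    case (nonneg n)
    then show ?thesis using nat by (simp add: int_pow_int)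
  next
    case (neg n)
    have "x [^] i = inv (x [^] Suc n)" "y [^] i = inv (y [^] Suc n)"
      using c neg int_pow_neg_int by blast+
    moreover have "u \<otimes> inv p = inv q \<otimes> u"
      if "u \<otimes> p = q \<otimes> u" "p \<in> carrier G" "q \<in> carrier G" for p q
    proof -
      have "u \<otimes> inv p = (inv q \<otimes> q) \<otimes> u \<otimes> inv p" using that(2,3) c by simp
      also have "\<dots> = inv q \<otimes> (u \<otimes> p) \<otimes> inv p" unfolding that(1) using that(2,3) c by (simp only: m_assoc inv_closed m_closed)
      also have "\<dots> = inv q \<otimes> u" using that(2,3) c by (simp add: m_assoc)
      finally show ?thesis .
    qed
    ultimately show ?thesis using nat[of "Suc n"] c by simp
  qed
qed

text \<open>
  The powers of \<open>t\<close> and their products with \<open>x\<close> form two disjoint cosets of the cyclic group generated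
  by \<open>t\<close>, hence a set of \<open>2 |t|\<close> elements, which is all of \<open>G\<close> exactly when the orders match.
\<close>

lemma order_eq_twice_ord_iff:
  assumes fin: "finite (carrier G)" and t: "t \<in> carrier G" and x: "x \<in> carrier G"
    and nx: "x \<notin> generate G {t}"
  shows "Coset.order G = 2 * ord t \<longleftrightarrow>
    (\<forall>g\<in>carrier G. \<exists>j::nat. g = t [^] j \<or> g = t [^] j \<otimes> x)"
proof -
  let ?T = "generate G {t}"
  let ?C = "(\<lambda>h. h \<otimes> x) ` ?T"
  have T: "?T = {t [^] (j::nat) | j. j \<in> UNIV}"
    using generate_pow_on_finite_carrier[OF fin t] by simp
  have Tsub: "subgroup ?T G" using t by (intro generate_is_subgroup) simp
  then have TG: "?T \<subseteq> carrier G" by (rule subgroup.subset)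
  have "inj_on (\<lambda>h. h \<otimes> x) ?T" using inj_on_multc[OF x] TG by (rule inj_on_subset)
  then have "card ?C = card ?T" by (rule card_image)
  moreover have "?T \<inter> ?C = {}"
  proof -
    have False if h: "h \<in> ?T" "h \<otimes> x \<in> ?T" for h
    proof -
      have "inv h \<otimes> (h \<otimes> x) \<in> ?T"
        using h Tsub subgroup.m_inv_closed subgroup.m_closed by metis
      moreover have "inv h \<otimes> (h \<otimes> x) = x" using h TG x by (simp add: m_assoc[symmetric] subset_iff)
      ultimately show False using nx by simp
    qed
    then show ?thesis by auto
  qed
  moreover have "finite ?T" using TG fin finite_subset by blast
  ultimately have card: "card (?T \<union> ?C) = 2 * ord t"
    using generate_pow_card[OF t] by (simp add: card_Un_disjoint)
  have sub: "?T \<union> ?C \<subseteq> carrier G" using TG x by auto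
  have "Coset.order G = 2 * ord t \<longleftrightarrow> carrier G \<subseteq> ?T \<union> ?C"
    using card sub card_subset_eq[OF fin sub] by (metis Coset.order_def subset_antisym subset_refl)
  also have "\<dots> \<longleftrightarrow> (\<forall>g\<in>carrier G. \<exists>j::nat. g = t [^] j \<or> g = t [^] j \<otimes> x)"
    unfolding T by blast
  finally show ?thesis .
qed

lemma comm_group_of_cyclic_generators:
  assumes t: "t \<in> carrier G" and xy: "x \<in> generate G {t}" "y \<in> generate G {t}"
    and gen: "generate G {x, y} = carrier G"
  shows "comm_group G"
proof (rule group_comm_groupI)
  have "carrier G \<subseteq> generate G {t}"
    unfolding gen[symmetric] using t xy by (intro generate_subgroup_incl generate_is_subgroup) auto
  then have pow: "\<exists>i::int. g = t [^] i" if "g \<in> carrier G" for g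
    using that generate_pow[OF t] by blast
  fix g h assume "g \<in> carrier G" "h \<in> carrier G"
  then obtain i j :: int where "g = t [^] i" "h = t [^] j" using pow by blast
  then show "g \<otimes> h = h \<otimes> g" using int_pow_mult[OF t] by (metis add.commute)
qed

text \<open>
  The elements \<open>x y\<close> and \<open>y x\<close> are conjugate.
\<close>

lemma ord_mult_commute:
  assumes "x \<in> carrier G" "y \<in> carrier G"
  shows "ord (x \<otimes> y) = ord (y \<otimes> x)"
proof -
  have *: "ord (q \<otimes> p) dvd ord (p \<otimes> q)" if pq: "p \<in> carrier G" "q \<in> carrier G" for p q
  proof -
    have "q \<otimes> (p \<otimes> q) = (q \<otimes> p) \<otimes> q" using pq by (simp add: m_assoc)
    from int_pow_intertwine[OF this, of "int (ord (p \<otimes> q))"] pq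
    have "q \<otimes> (p \<otimes> q) [^] ord (p \<otimes> q) = (q \<otimes> p) [^] ord (p \<otimes> q) \<otimes> q" by (simp add: int_pow_int)
    then have "(q \<otimes> p) [^] ord (p \<otimes> q) = \<one>" using pq by simp
    then show ?thesis using pq pow_eq_id by auto
  qed
  show ?thesis using *[OF assms] *[OF assms(2,1)] by (simp add: dvd_antisym)
qed

text \<open>
  If \<open>x\<close> were a power of \<open>x y\<close>, then so would be \<open>y\<close>, and \<open>G\<close> would be cyclic.
\<close>

lemma order_eq_twice_ord_mult_iff:
  assumes fin: "finite (carrier G)" and nc: "\<not> comm_group G"
    and x: "x \<in> carrier G" and y: "y \<in> carrier G" and gen: "generate G {x, y} = carrier G"
  shows "Coset.order G = 2 * ord (x \<otimes> y) \<longleftrightarrow>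
    (\<forall>g\<in>carrier G. \<exists>j::nat. g = (x \<otimes> y) [^] j \<or> g = (x \<otimes> y) [^] j \<otimes> x)"
proof (rule order_eq_twice_ord_iff[OF fin _ x])
  show t: "x \<otimes> y \<in> carrier G" using x y by simp
  show "x \<notin> generate G {x \<otimes> y}"
  proof
    assume xT: "x \<in> generate G {x \<otimes> y}"
    have sub: "subgroup (generate G {x \<otimes> y}) G" using t by (intro generate_is_subgroup) simp
    have "inv x \<otimes> (x \<otimes> y) \<in> generate G {x \<otimes> y}"
      by (rule subgroup.m_closed[OF sub subgroup.m_inv_closed[OF sub xT]]) (simp add: generate.incl)
    then have "y \<in> generate G {x \<otimes> y}" using x y by (simp add: m_assoc[symmetric])
    then show False using comm_group_of_cyclic_generators[OF t xT _ gen] nc by simp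
  qed
qed

end

section \<open>Alternating words\<close>

text \<open>
  The weights of the alternating words \<open>uvuv\<dots>\<close> and \<open>vuvu\<dots>\<close> of length \<open>n\<close>.  Their first coordinates are
  the two extreme values allowed in \<open>klein_monoid\<close>: all letters \<open>v\<close> stand at odd positions in the former
  word and at even positions in the latter.
\<close>

definition alternating_u :: "nat \<Rightarrow> klein" where "alternating_u n = Klein (int n div 2) (int n)"
definition alternating_v :: "nat \<Rightarrow> klein" where "alternating_v n = Klein (- ((int n + 1) div 2)) (int n)"

text \<open>
  Write \<open>x\<close> as a negative power of \<open>u\<^sup>2\<close> times an alternating word.  If this word ends in \<open>v\<close>, then nothing
  cancels in its product with an alternating word starting with \<open>u\<close>; if it ends in \<open>u\<close>, the same
  holds for words starting with \<open>v\<close>.  In coordinates, \<open>x\<close> violates one of the two bounds, and the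
  extremal weights preserve the violation; for \<open>x\<close> of odd length the first coordinate of \<open>m\<close> enters with
  a reversed sign, so the roles of the two words are exchanged.
\<close>

lemma outside_shift_alternating:
  assumes "x \<notin> klein_monoid"
  shows "(\<forall>n. x + alternating_u n \<notin> klein_monoid) \<or> (\<forall>n. x + alternating_v n \<notin> klein_monoid)"
proof (cases "even (len x)")
  case True
  then obtain r where r: "len x = 2 * r" by (elim evenE)
  consider "rot x > r" | "rot x < - r"
    using assms r by (force simp: klein_monoid_def)
  then show ?thesis
  proof cases
    case 1
    then have "x + alternating_u n \<notin> klein_monoid" for n
      using r unfolding klein_monoid_def alternating_u_def by simp
    then show ?thesis by blast
  next
    case 2
    then have "x + alternating_v n \<notin> klein_monoid" for n
      using r unfolding klein_monoid_def alternating_v_def by simp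
    then show ?thesis by blast
  qed
next
  case False
  then obtain r where r: "len x = 2 * r + 1" by (elim oddE)
  consider "rot x > r" | "rot x < - r - 1"
    using assms r by (force simp: klein_monoid_def)
  then show ?thesis
  proof cases
    case 1
    have "x + alternating_v n \<notin> klein_monoid" for n
      using 1 r unfolding klein_monoid_def alternating_v_def by simp presburger
    then show ?thesis by blast
  next
    case 2
    have "x + alternating_u n \<notin> klein_monoid" for n
      using 2 r unfolding klein_monoid_def alternating_u_def by simp
    then show ?thesis by blast
  qed
qed

lemma alternating_mem: "alternating_u n \<in> klein_monoid" "alternating_v n \<in> klein_monoid"
  by (simp_all add: klein_monoid_def alternating_u_def alternating_v_def)

text \<open>
  The element \<open>(-1, -1)\<close> is \<open>u\<^sup>-\<^sup>2 v\<close>, so the product with \<open>m\<close> leaves the monoid only if \<open>m\<close> contains no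
  factor \<open>u\<^sup>2\<close> and does not start with \<open>v\<close>.
\<close>

lemma shift_outside_imp_alternating_u:
  assumes "m \<in> klein_monoid" "Klein (- 1) (- 1) + m \<notin> klein_monoid"
  shows "\<exists>n. m = alternating_u n"
proof -
  have "rot m = len m div 2"
    using assms by (simp add: klein_monoid_def) presburger
  then have "m = alternating_u (nat (len m))"
    using klein_monoid_len[OF assms(1)] by (auto intro!: klein.expand simp: alternating_u_def)
  then show ?thesis by blast
qed

section \<open>Degrees of elements of the Klein bottle group\<close>

locale equal_squares = group G
  for G :: "('g, 'm) monoid_scheme" (structure) +
  fixes a b :: 'g
  assumes finite_carrier: "finite (carrier G)"
    and gens: "a \<in> carrier G" "b \<in> carrier G" "generate G {a, b} = carrier G"
    and squares: "a \<otimes> a = b \<otimes> b"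
begin

text \<open>
  The homomorphism to \<open>G\<close> with \<open>u\<close> mapped to \<open>a\<close> and \<open>v\<close> to \<open>b\<close>: the first factor of the Klein bottle
  group is generated by \<open>u v\<^sup>-\<^sup>1\<close> and the second one by \<open>u\<close>.
\<close>

definition klein_degree :: "klein \<Rightarrow> 'g" where
  "klein_degree x = (a \<otimes> inv b) [^] rot x \<otimes> a [^] len x"

lemma klein_degree_closed [simp]: "klein_degree x \<in> carrier G"
  using gens by (simp add: klein_degree_def)

text \<open>
  The relation \<open>a\<^sup>2 = b\<^sup>2\<close> says that conjugation by \<open>a\<close> inverts \<open>a b\<^sup>-\<^sup>1\<close>, as the semidirect product
  requires.
\<close>

lemma klein_degree_add: "klein_degree (x + y) = klein_degree x \<otimes> klein_degree y"
proof -
  let ?c = "a \<otimes> inv b"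
  have c: "?c \<in> carrier G" using gens by simp
  have "b \<otimes> b \<otimes> inv b = b" using gens by (simp add: m_assoc)
  then have "a \<otimes> ?c = inv ?c \<otimes> a"
    using gens squares by (simp add: inv_mult_group m_assoc[symmetric]) (simp add: m_assoc)
  from int_pow_intertwine[OF this] have odd1: "a \<otimes> ?c [^] i = ?c [^] (- i) \<otimes> a" for i :: int
    using gens c by (simp add: int_pow_neg int_pow_inv)
  have sq: "?c [^] i \<otimes> (a [^] (2::int)) = (a [^] (2::int)) \<otimes> ?c [^] i" for i :: int
  proof -
    have "(a \<otimes> a) \<otimes> ?c [^] i = a \<otimes> (?c [^] (- i) \<otimes> a)" using gens c odd1[of i] by (simp add: m_assoc)
    also have "\<dots> = (a \<otimes> ?c [^] (- i)) \<otimes> a" using gens c by (simp add: m_assoc)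
    also have "\<dots> = ?c [^] i \<otimes> (a \<otimes> a)" unfolding odd1 using gens c by (simp add: m_assoc)
    finally show ?thesis using gens int_pow_mult[of a 1 1] by simp
  qed
  have even: "a [^] (2 * k) \<otimes> ?c [^] i = ?c [^] i \<otimes> a [^] (2 * k)" for i k :: int
    using int_pow_intertwine[OF sq, of i k] gens c by (simp add: int_pow_pow)
  have odd: "a [^] (2 * k + 1) \<otimes> ?c [^] i = ?c [^] (- i) \<otimes> a [^] (2 * k + 1)" for i k :: int
  proof -
    have "a [^] (2 * k + 1) \<otimes> ?c [^] i = a [^] (2 * k) \<otimes> (a \<otimes> ?c [^] i)"
      using gens c by (simp add: int_pow_mult m_assoc)
    also have "\<dots> = (a [^] (2 * k) \<otimes> ?c [^] (- i)) \<otimes> a" unfolding odd1 using gens c by (simp add: m_assoc)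
    also have "\<dots> = ?c [^] (- i) \<otimes> a [^] (2 * k + 1)"
      unfolding even using gens c by (simp add: int_pow_mult m_assoc)
    finally show ?thesis .
  qed
  let ?i = "if even (len x) then rot y else - rot y"
  have swap: "a [^] len x \<otimes> ?c [^] rot y = ?c [^] ?i \<otimes> a [^] len x"
    using even odd by (cases "even (len x)") (auto elim!: evenE oddE)
  have "klein_degree x \<otimes> klein_degree y = ?c [^] rot x \<otimes> (a [^] len x \<otimes> ?c [^] rot y) \<otimes> a [^] len y"
    using gens c by (simp add: klein_degree_def m_assoc)
  also have "\<dots> = klein_degree (x + y)"
    unfolding swap using gens c by (simp add: klein_degree_def int_pow_mult m_assoc)
  finally show ?thesis by simp
qed

lemma klein_degree_zero [simp]: "klein_degree 0 = \<one>"
  by (simp add: klein_degree_def)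

lemma klein_degree_uminus: "klein_degree (- x) = inv (klein_degree x)"
  using klein_degree_add[of "- x" x] by (simp add: inv_equality)

lemma klein_degree_letter: "klein_degree (letter_weight x) = uv_deg a b x"
proof (cases x)
  case Gen_v
  have "klein_degree (letter_weight Gen_v) = b \<otimes> (inv a \<otimes> a)"
    using gens by (simp add: klein_degree_def int_pow_neg inv_mult_group m_assoc del: l_inv)
  then show ?thesis using Gen_v gens by simp
qed (use gens in \<open>simp add: klein_degree_def\<close>)

lemma word_deg_eq_klein_degree: "word_deg G (uv_deg a b) w = klein_degree (weight w)"
proof -
  have "word_deg G (uv_deg a b) (Word xs) = klein_degree (weight (Word xs))" for xs
    by (induction xs) (simp_all add: word_deg_def weight_Nil weight_Cons klein_degree_add klein_degree_letter)
  then show ?thesis by (cases w) simp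
qed

lemma klein_degree_surj:
  assumes "g \<in> carrier G"
  shows "\<exists>x. klein_degree x = g"
proof -
  have "subgroup (range klein_degree) G"
  proof (rule subgroupI)
    fix p assume "p \<in> range klein_degree"
    then obtain x where p: "p = klein_degree x" by blast
    show "inv p \<in> range klein_degree" unfolding p klein_degree_uminus[symmetric] by (rule rangeI)
    fix q assume "q \<in> range klein_degree"
    then obtain y where q: "q = klein_degree y" by blast
    show "p \<otimes> q \<in> range klein_degree" unfolding p q klein_degree_add[symmetric] by (rule rangeI)
  qed auto
  moreover have "{a, b} \<subseteq> range klein_degree"
    using rangeI[of klein_degree "letter_weight Gen_u"] rangeI[of klein_degree "letter_weight Gen_v"]
    unfolding klein_degree_letter by simp
  ultimately have "carrier G \<subseteq> range klein_degree"
    unfolding gens(3)[symmetric] by (intro generate_subgroup_incl)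
  then show ?thesis using assms by auto
qed

text \<open>
  Every element of the group is brought into the monoid by a high power of the central element \<open>u\<^sup>2\<close>,
  and a power with exponent divisible by the order of \<open>G\<close> has degree \<open>1\<close>, that is, it is an invariant of \<open>A\<close>.
\<close>

lemma shift_into_klein_monoid:
  obtains z where "z \<in> klein_monoid" "x + z \<in> klein_monoid" "klein_degree z = \<one>"
proof
  \<comment> \<open>The last factor makes \<open>2 k\<close> exceed both coordinates of \<open>x\<close> in absolute value.\<close>
  define k where "k = int (Coset.order G) * (\<bar>rot x\<bar> + \<bar>len x\<bar> + 1)"
  let ?z = "Klein 0 (2 * k)"
  have "0 < Coset.order G" using finite_carrier by (simp add: order_gt_0_iff_finite)
  then have k: "\<bar>rot x\<bar> + \<bar>len x\<bar> + 1 \<le> k"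
    unfolding k_def using mult_right_mono[of 1 "int (Coset.order G)" "\<bar>rot x\<bar> + \<bar>len x\<bar> + 1"] by simp
  show "?z \<in> klein_monoid" using k by (simp add: klein_monoid_def)
  show "x + ?z \<in> klein_monoid" using k by (simp add: klein_monoid_def) linarith
  have "a [^] (2 * k) = (a [^] int (Coset.order G)) [^] (2 * (\<bar>rot x\<bar> + \<bar>len x\<bar> + 1))"
    using gens by (simp add: k_def int_pow_pow mult_ac)
  also have "\<dots> = \<one>" using gens by (simp add: int_pow_int pow_order_eq_1)
  finally show "klein_degree ?z = \<one>" by (simp add: klein_degree_def)
qed

lemma klein_degree_surj_pos:
  assumes "g \<in> carrier G"
  obtains m where "m \<in> klein_monoid" "klein_degree m = g"
proof -
  obtain x where x: "klein_degree x = g" using klein_degree_surj[OF assms] by blast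
  obtain z where "x + z \<in> klein_monoid" "klein_degree z = \<one>" using shift_into_klein_monoid[of x] by metis
  then show ?thesis using that[of "x + z"] x assms by (auto simp: klein_degree_add)
qed

section \<open>Degrees of alternating words\<close>

lemma klein_degree_alternating_u:
  "klein_degree (alternating_u (2 * j)) = (a \<otimes> b) [^] j" "klein_degree (alternating_u (2 * j + 1)) = (a \<otimes> b) [^] j \<otimes> a"
proof -
  have step: "alternating_u (2 * Suc j) = alternating_u (2 * j) + letter_weight Gen_u + letter_weight Gen_v" for j
    by (auto intro!: klein.expand simp: alternating_u_def)
  have "alternating_u 0 = 0" by (auto intro!: klein.expand simp: alternating_u_def)
  then show even: "klein_degree (alternating_u (2 * j)) = (a \<otimes> b) [^] j"
    using gens by (induction j) (simp_all only: step klein_degree_add klein_degree_letter, simp_all add: m_assoc)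
  have "alternating_u (2 * j + 1) = alternating_u (2 * j) + letter_weight Gen_u"
    by (auto intro!: klein.expand simp: alternating_u_def)
  then show "klein_degree (alternating_u (2 * j + 1)) = (a \<otimes> b) [^] j \<otimes> a"
    using even by (simp only: klein_degree_add klein_degree_letter uv_deg.simps)
qed

lemma klein_degree_alternating_v:
  "klein_degree (alternating_v (2 * j)) = (b \<otimes> a) [^] j" "klein_degree (alternating_v (2 * j + 1)) = (b \<otimes> a) [^] j \<otimes> b"
proof -
  have step: "alternating_v (2 * Suc j) = alternating_v (2 * j) + letter_weight Gen_v + letter_weight Gen_u" for j
    by (auto intro!: klein.expand simp: alternating_v_def)
  have "alternating_v 0 = 0" by (auto intro!: klein.expand simp: alternating_v_def)
  then show even: "klein_degree (alternating_v (2 * j)) = (b \<otimes> a) [^] j"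
    using gens by (induction j) (simp_all only: step klein_degree_add klein_degree_letter, simp_all add: m_assoc)
  have "alternating_v (2 * j + 1) = alternating_v (2 * j) + letter_weight Gen_v"
    by (auto intro!: klein.expand simp: alternating_v_def)
  then show "klein_degree (alternating_v (2 * j + 1)) = (b \<otimes> a) [^] j \<otimes> b"
    using even by (simp only: klein_degree_add klein_degree_letter uv_deg.simps)
qed

lemma order_eq_twice_ord_iff_alternating:
  assumes "\<not> comm_group G"
  shows "Coset.order G = 2 * ord (a \<otimes> b) \<longleftrightarrow> (\<forall>g\<in>carrier G. \<exists>n. klein_degree (alternating_u n) = g)"
    and "Coset.order G = 2 * ord (a \<otimes> b) \<longleftrightarrow> (\<forall>g\<in>carrier G. \<exists>n. klein_degree (alternating_v n) = g)"
proof -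
  have parity: "(\<exists>n. klein_degree (alt n) = g) \<longleftrightarrow> (\<exists>j. g = klein_degree (alt (2 * j)) \<or> g = klein_degree (alt (2 * j + 1)))"
    for alt :: "nat \<Rightarrow> klein" and g
  proof
    assume "\<exists>n. klein_degree (alt n) = g"
    then obtain n where "klein_degree (alt n) = g" by blast
    then show "\<exists>j. g = klein_degree (alt (2 * j)) \<or> g = klein_degree (alt (2 * j + 1))"
      by (cases "even n") (auto elim!: evenE oddE)
  qed auto
  show "Coset.order G = 2 * ord (a \<otimes> b) \<longleftrightarrow> (\<forall>g\<in>carrier G. \<exists>n. klein_degree (alternating_u n) = g)"
    unfolding parity klein_degree_alternating_u
    by (rule order_eq_twice_ord_mult_iff) (use finite_carrier gens assms in auto)
  show "Coset.order G = 2 * ord (a \<otimes> b) \<longleftrightarrow> (\<forall>g\<in>carrier G. \<exists>n. klein_degree (alternating_v n) = g)"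
    unfolding parity klein_degree_alternating_v ord_mult_commute[OF gens(1,2)]
    by (rule order_eq_twice_ord_mult_iff) (use finite_carrier gens assms in \<open>auto simp: insert_commute\<close>)
qed

end

section \<open>Bijectivity of the Auslander map\<close>

context equal_squares
begin

text \<open>
  The left-hand side is the condition to which bijectivity of the Auslander map is reduced below.
  Testing it on the single element \<open>u\<^sup>-\<^sup>2 v\<close> already shows that \<open>G\<close> consists of the degrees of the
  alternating words starting with \<open>u\<close>; the converse uses the words starting with \<open>v\<close> as well.
\<close>

lemma saturated_iff:
  assumes nc: "\<not> comm_group G"
  shows "(\<forall>g\<in>carrier G. \<forall>x. (\<forall>m\<in>klein_monoid. klein_degree m = g \<longrightarrow> x + m \<in> klein_monoid) \<longrightarrow> x \<in> klein_monoid)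
    \<longleftrightarrow> Coset.order G = 2 * ord (a \<otimes> b)" (is "?S \<longleftrightarrow> ?O")
proof
  assume S: ?S
  have "\<exists>n. klein_degree (alternating_u n) = g" if g: "g \<in> carrier G" for g
  proof -
    have "Klein (- 1) (- 1) \<notin> klein_monoid" by (simp add: klein_monoid_def)
    then obtain m where "m \<in> klein_monoid" "klein_degree m = g" "Klein (- 1) (- 1) + m \<notin> klein_monoid"
      using S g by blast
    then show ?thesis using shift_outside_imp_alternating_u by blast
  qed
  then show ?O using order_eq_twice_ord_iff_alternating(1)[OF nc] by blast
next
  assume O: ?O
  show ?S
  proof (intro ballI allI impI, rule ccontr)
    fix g x assume g: "g \<in> carrier G" and x: "\<forall>m\<in>klein_monoid. klein_degree m = g \<longrightarrow> x + m \<in> klein_monoid" "x \<notin> klein_monoid"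
    obtain n n' where "klein_degree (alternating_u n) = g" "klein_degree (alternating_v n') = g"
      using O order_eq_twice_ord_iff_alternating[OF nc] g by blast
    then show False using outside_shift_alternating[OF x(2)] x(1) alternating_mem by blast
  qed
qed

lemma graded_algebra_uv_algebra: "graded_algebra G
    (uv_algebra :: ('k::field, (uv, 'k) free_alg_elem set) module) (uv_grading G a b)"
  by (rule graded_algebra_uv[OF is_group finite_carrier gens(1,2) squares])

lemma uv_grading_iff:
  fixes x :: "(uv, 'k::field) free_alg_elem set"
  shows "x \<in> uv_grading G a b g \<longleftrightarrow>
    x \<in> carrier uv_algebra \<and> (\<forall>m\<in>Poly_Mapping.keys (klein_embed x). klein_degree m = g)"
proof
  assume "x \<in> uv_grading G a b g"
  then obtain p where p: "x = uv_class p" "\<forall>w\<in>Poly_Mapping.keys p. klein_degree (weight w) = g"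
    by (auto simp: uv_grading_def word_deg_eq_klein_degree)
  then show "x \<in> carrier uv_algebra \<and> (\<forall>m\<in>Poly_Mapping.keys (klein_embed x). klein_degree m = g)"
    using keys_push_forward[of weight p] unfolding p(1) klein_embed_class carrier_uv_algebra by blast
next
  assume x: "x \<in> carrier uv_algebra \<and> (\<forall>m\<in>Poly_Mapping.keys (klein_embed x). klein_degree m = g)"
  have "word_deg G (uv_deg a b) w = g" if w: "w \<in> Poly_Mapping.keys (push_forward word_of (klein_embed x))" for w
  proof -
    obtain m where m: "w = word_of m" "m \<in> Poly_Mapping.keys (klein_embed x)"
      using subsetD[OF keys_push_forward w] by auto
    have "m \<in> klein_monoid" using subsetD[OF keys_klein_embed m(2)] x by simp
    then have "weight w = m" unfolding m(1) by (rule weight_word_of)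
    then show ?thesis using x m by (simp add: word_deg_eq_klein_degree)
  qed
  moreover have "x = uv_class (push_forward word_of (klein_embed x))"
    using of_klein_klein_embed[of x] x by (simp add: of_klein_def)
  ultimately show "x \<in> uv_grading G a b g" unfolding uv_grading_def by blast
qed

lemma of_klein_single_grading:
  "m \<in> klein_monoid \<Longrightarrow> of_klein (Poly_Mapping.single m c) \<in> uv_grading G a b (klein_degree m)"
  by (simp add: uv_grading_iff of_klein_closed klein_embed_single)

text \<open>
  The coefficient \<open>F(g)\<close> is recovered from the value at any monomial of degree \<open>g\<close>, since monomials can
  be cancelled.
\<close>

lemma auslander_map_inj:
  "inj_on (auslander_map G (uv_algebra :: ('k::field, (uv, 'k) free_alg_elem set) module) (uv_grading G a b))
     (carrier (smash_product G uv_algebra (uv_grading G a b)))"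
proof -
  interpret U: graded_algebra G "uv_algebra :: ('k, (uv, 'k) free_alg_elem set) module" "uv_grading G a b"
    by (rule graded_algebra_uv_algebra)
  show ?thesis
  proof (rule inj_onI)
    fix F F' :: "'g \<Rightarrow> (uv, 'k) free_alg_elem set"
    assume F: "F \<in> carrier (smash_product G uv_algebra (uv_grading G a b))"
      and F': "F' \<in> carrier (smash_product G uv_algebra (uv_grading G a b))"
      and eq: "auslander_map G uv_algebra (uv_grading G a b) F = auslander_map G uv_algebra (uv_grading G a b) F'"
    show "F = F'"
    proof (rule extensionalityI)
      show "F \<in> extensional (carrier G)" "F' \<in> extensional (carrier G)"
        using F F' by (auto simp: smash_product_def PiE_def)
      fix g assume g: "g \<in> carrier G"
      then obtain m where m: "m \<in> klein_monoid" "klein_degree m = g" by (rule klein_degree_surj_pos)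
      let ?m = "of_klein (Poly_Mapping.single m 1) :: (uv, 'k) free_alg_elem set"
      have mg: "?m \<in> uv_grading G a b g" using of_klein_single_grading[OF m(1)] m(2) by simp
      have Fg: "F g \<in> carrier uv_algebra" "F' g \<in> carrier uv_algebra"
        using U.smash_carrier_closed F F' g by blast+
      have "F g \<otimes>\<^bsub>uv_algebra\<^esub> ?m = F' g \<otimes>\<^bsub>uv_algebra\<^esub> ?m"
        using U.auslander_map_homogeneous[OF F g mg] U.auslander_map_homogeneous[OF F' g mg] eq by simp
      then have "klein_embed (F g) * klein_embed ?m = klein_embed (F' g) * klein_embed ?m"
        using klein_embed_mult[OF Fg(1) of_klein_closed] klein_embed_mult[OF Fg(2) of_klein_closed] by metis
      then have "klein_embed (F g) = klein_embed (F' g)"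
        unfolding klein_embed_single[OF m(1)] by (rule mult_single_right_cancel)
      then show "F g = F' g"
        unfolding klein_embed_inj[OF Fg] .
    qed
  qed
qed

text \<open>
  Left multiplication by \<open>x\<close> on the component of degree \<open>g\<close>, extended by \<open>0\<close>, is an endomorphism of \<open>A\<close> as
  soon as it maps that component into \<open>A\<close>.  If it comes from the smash product, then its coefficient at
  \<open>g\<close> can only be \<open>x\<close>, which therefore lies in \<open>A\<close>.
\<close>

lemma saturated_if_auslander_map_surj:
  assumes surj: "carrier (right_End (uv_algebra :: ('k::field, (uv, 'k) free_alg_elem set) module)
        (inv_ring G uv_algebra (uv_grading G a b)))
      \<subseteq> auslander_map G uv_algebra (uv_grading G a b) ` carrier (smash_product G uv_algebra (uv_grading G a b))"
    and g: "g \<in> carrier G" and x: "\<And>m. m \<in> klein_monoid \<Longrightarrow> klein_degree m = g \<Longrightarrow> x + m \<in> klein_monoid"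
  shows "x \<in> klein_monoid"
proof -
  let ?gr = "uv_grading G a b :: 'g \<Rightarrow> (uv, 'k) free_alg_elem set set"
  let ?A = "uv_algebra :: ('k::field, (uv, 'k) free_alg_elem set) module"
  interpret U: graded_algebra G ?A ?gr by (rule graded_algebra_uv_algebra)
  define L where "L y = Poly_Mapping.single x 1 * klein_embed (hom_component G ?A ?gr g y)" for y
  define f where "f = (\<lambda>y\<in>carrier ?A. of_klein (L y))"
  note cl = U.hom_component_closed
  have keys_L: "Poly_Mapping.keys (L y) \<subseteq> klein_monoid" if y: "y \<in> carrier ?A" for y
  proof -
    have "Poly_Mapping.keys (klein_embed (hom_component G ?A ?gr g y)) \<subseteq> {m \<in> klein_monoid. klein_degree m = g}"
      using U.hom_component_mem[OF g y] keys_klein_embed[OF cl[OF g y]] by (auto simp: uv_grading_iff)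
    moreover have "Poly_Mapping.keys (L y)
        \<subseteq> {x + m | m. m \<in> Poly_Mapping.keys (klein_embed (hom_component G ?A ?gr g y))}"
      unfolding L_def using Poly_Mapping.keys_mult[of "Poly_Mapping.single x (1::'k)"] by fastforce
    ultimately show ?thesis using x by blast
  qed
  have embed_f: "klein_embed (f y) = L y" if "y \<in> carrier ?A" for y
    unfolding f_def using that klein_embed_of_klein[OF keys_L[OF that]] by simp
  have f_closed: "f y \<in> carrier ?A" if "y \<in> carrier ?A" for y
    unfolding f_def using that of_klein_closed by simp
  have "f \<in> carrier (right_End ?A (inv_ring G ?A ?gr))"
  proof -
    have "f (y \<oplus>\<^bsub>?A\<^esub> z) = f y \<oplus>\<^bsub>?A\<^esub> f z" if "y \<in> carrier ?A" "z \<in> carrier ?A" for y z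
    proof -
      have "L (y \<oplus>\<^bsub>?A\<^esub> z) = L y + L z"
        unfolding L_def using that g cl by (simp add: U.hom_component_add klein_embed_add distrib_left)
      then show ?thesis using that by (simp add: f_def of_klein_add)
    qed
    moreover have "f (y \<otimes>\<^bsub>?A\<^esub> r) = f y \<otimes>\<^bsub>?A\<^esub> r" if y: "y \<in> carrier ?A" and r: "r \<in> ?gr \<one>" for y r
    proof -
      have rc: "r \<in> carrier ?A" using U.gr_carrier r by blast
      have "klein_embed (f (y \<otimes>\<^bsub>?A\<^esub> r)) = klein_embed (f y \<otimes>\<^bsub>?A\<^esub> r)"
        using U.hom_component_mult[OF g one_closed y r] y rc g cl f_closed
        by (simp add: klein_embed_mult embed_f L_def mult.assoc)
      then show ?thesis
        using klein_embed_inj[OF f_closed[OF U.A.m_closed[OF y rc]] U.A.m_closed[OF f_closed[OF y] rc]] by simp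
    qed
    ultimately show ?thesis
      using f_closed by (auto simp: right_End_def U.inv_ring_eq f_def)
  qed
  then obtain F where F: "F \<in> carrier (smash_product G ?A ?gr)" "f = auslander_map G ?A ?gr F"
    using surj by blast
  obtain m where m: "m \<in> klein_monoid" "klein_degree m = g" using g by (rule klein_degree_surj_pos)
  let ?m = "of_klein (Poly_Mapping.single m 1) :: (uv, 'k) free_alg_elem set"
  have mg: "?m \<in> ?gr g" using of_klein_single_grading[OF m(1)] m(2) by simp
  have Fg: "F g \<in> carrier ?A" using U.smash_carrier_closed F(1) g .
  have "klein_embed (f ?m) = klein_embed (F g) * klein_embed ?m"
    unfolding F(2) U.auslander_map_homogeneous[OF F(1) g mg]
    using Fg by (simp add: klein_embed_mult of_klein_closed)
  moreover have "klein_embed (f ?m) = Poly_Mapping.single x 1 * klein_embed ?m"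
    by (simp add: embed_f[OF of_klein_closed] L_def U.hom_component_homogeneous[OF g g mg])
  ultimately have "klein_embed (F g) * klein_embed ?m = Poly_Mapping.single x 1 * klein_embed ?m"
    by (rule trans[OF sym])
  then have "klein_embed (F g) = Poly_Mapping.single x 1"
    unfolding klein_embed_single[OF m(1)] by (rule mult_single_right_cancel)
  then show ?thesis using keys_klein_embed[OF Fg] by simp
qed

text \<open>
  The quotient of \<open>f(n)\<close> by the monomial \<open>n\<close> on the right depends only on the degree of \<open>n\<close>.  Indeed
  \<open>- m + n\<close> has degree \<open>1\<close> and becomes an invariant monomial after adding a suitable central invariant
  \<open>z\<close>, so linearity compares the values of \<open>f\<close> at \<open>m\<close> and \<open>n\<close>.  The scalar \<open>c\<close> is absorbed into
  the invariant monomial, so linearity of \<open>f\<close> over the field is a case of linearity over \<open>A\<^sub>1\<close>.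
\<close>

lemma endomorphism_of_klein_single:
  fixes f :: "(uv, 'k::field) free_alg_elem set \<Rightarrow> (uv, 'k) free_alg_elem set"
  assumes f: "f \<in> carrier (right_End uv_algebra (inv_ring G uv_algebra (uv_grading G a b)))"
    and m: "m \<in> klein_monoid" and n: "n \<in> klein_monoid" and deg: "klein_degree m = klein_degree n"
  shows "klein_embed (f (of_klein (Poly_Mapping.single n c))) =
    klein_embed (f (of_klein (Poly_Mapping.single m 1))) * Poly_Mapping.single (- m + n) c"
proof -
  let ?A = "uv_algebra :: ('k::field, (uv, 'k) free_alg_elem set) module"
  let ?e = "\<lambda>m c. of_klein (Poly_Mapping.single m c) :: (uv, 'k) free_alg_elem set"
  interpret U: graded_algebra G ?A "uv_grading G a b" by (rule graded_algebra_uv_algebra)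
  obtain z where z: "z \<in> klein_monoid" "- m + n + z \<in> klein_monoid" "n + z \<in> klein_monoid" "klein_degree z = \<one>"
  proof (rule shift_into_klein_monoid[of "- m + n"])
    fix z assume "z \<in> klein_monoid" "- m + n + z \<in> klein_monoid" "klein_degree z = \<one>"
    then show thesis using klein_monoid_add[OF n, of z] that[of z] by simp
  qed
  have fc: "f y \<in> carrier ?A" if "y \<in> carrier ?A" for y using f that by (auto simp: right_End_def)
  have fr: "f (y \<otimes>\<^bsub>?A\<^esub> ?e r d) = f y \<otimes>\<^bsub>?A\<^esub> ?e r d"
    if "y \<in> carrier ?A" "r \<in> klein_monoid" "klein_degree r = \<one>" for y r d
    using f that of_klein_single_grading[of r d] by (auto simp: right_End_def U.inv_ring_eq)
  have d: "klein_degree (- m + n + z) = \<one>" using deg z(4) by (simp add: klein_degree_add klein_degree_uminus)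
  have "m + (- m + n + z) = n + z" by (simp add: add.assoc[symmetric])
  then have "?e m 1 \<otimes>\<^bsub>?A\<^esub> ?e (- m + n + z) c = ?e n c \<otimes>\<^bsub>?A\<^esub> ?e z 1"
    using z m n by (simp add: of_klein_mult_single)
  then have "f (?e m 1) \<otimes>\<^bsub>?A\<^esub> ?e (- m + n + z) c = f (?e n c) \<otimes>\<^bsub>?A\<^esub> ?e z 1"
    unfolding fr[OF of_klein_closed z(2) d, symmetric] fr[OF of_klein_closed z(1) z(4), symmetric] by simp
  then have "klein_embed (f (?e m 1)) * klein_embed (?e (- m + n + z) c) = klein_embed (f (?e n c)) * klein_embed (?e z 1)"
    using klein_embed_mult[OF fc[OF of_klein_closed] of_klein_closed] by metis
  then have "klein_embed (f (?e m 1)) * Poly_Mapping.single (- m + n) c * Poly_Mapping.single z 1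
      = klein_embed (f (?e n c)) * Poly_Mapping.single z 1"
    by (simp add: klein_embed_single z(1,2) mult.assoc mult_single)
  then show ?thesis by (rule mult_single_right_cancel[symmetric])
qed

text \<open>
  The coefficients \<open>Q g\<close> are the common quotients of the values of \<open>f\<close> at the monomials of degree \<open>g\<close>.
  They live in the group algebra of the Klein bottle group, and the hypothesis on \<open>klein_monoid\<close> is
  what brings them back into \<open>A\<close>.
\<close>

lemma auslander_map_surj_if_saturated:
  fixes f :: "(uv, 'k::field) free_alg_elem set \<Rightarrow> (uv, 'k) free_alg_elem set"
  assumes f: "f \<in> carrier (right_End uv_algebra (inv_ring G uv_algebra (uv_grading G a b)))"
    and sat: "\<And>g x. g \<in> carrier G \<Longrightarrow> (\<forall>m\<in>klein_monoid. klein_degree m = g \<longrightarrow> x + m \<in> klein_monoid) \<Longrightarrow> x \<in> klein_monoid"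
  shows "\<exists>F\<in>carrier (smash_product G uv_algebra (uv_grading G a b)).
    auslander_map G uv_algebra (uv_grading G a b) F = f"
proof -
  let ?gr = "uv_grading G a b :: 'g \<Rightarrow> (uv, 'k) free_alg_elem set set"
  let ?A = "uv_algebra :: ('k::field, (uv, 'k) free_alg_elem set) module"
  let ?e = "\<lambda>m c. of_klein (Poly_Mapping.single m c) :: (uv, 'k) free_alg_elem set"
  interpret U: graded_algebra G ?A ?gr by (rule graded_algebra_uv_algebra)
  have fc: "f y \<in> carrier ?A" if "y \<in> carrier ?A" for y using f that by (auto simp: right_End_def)
  have fadd: "f (y \<oplus>\<^bsub>?A\<^esub> z) = f y \<oplus>\<^bsub>?A\<^esub> f z" if "y \<in> carrier ?A" "z \<in> carrier ?A" for y z
    using f that by (auto simp: right_End_def)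
  have "\<forall>g\<in>carrier G. \<exists>m\<in>klein_monoid. klein_degree m = g" using klein_degree_surj_pos by metis
  then obtain M where M: "\<And>g. g \<in> carrier G \<Longrightarrow> M g \<in> klein_monoid" "\<And>g. g \<in> carrier G \<Longrightarrow> klein_degree (M g) = g"
    by metis
  define Q where "Q g = klein_embed (f (?e (M g) 1)) * Poly_Mapping.single (- M g) 1" for g
  have fe: "klein_embed (f (?e n c)) = Q g * Poly_Mapping.single n c"
    if "g \<in> carrier G" "n \<in> klein_monoid" "klein_degree n = g" for g n c
    using endomorphism_of_klein_single[OF f M(1) that(2), of g c] M(2) that
    by (simp add: Q_def mult.assoc mult_single)
  have Q_pos: "Poly_Mapping.keys (Q g) \<subseteq> klein_monoid" if g: "g \<in> carrier G" for g
  proof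
    fix x assume x: "x \<in> Poly_Mapping.keys (Q g)"
    have "x + m \<in> klein_monoid" if m: "m \<in> klein_monoid" "klein_degree m = g" for m
    proof -
      have "Poly_Mapping.lookup (Q g * Poly_Mapping.single m 1) (x + m) = Poly_Mapping.lookup (Q g) x"
        by (rule lookup_mult_single_add)
      then have "x + m \<in> Poly_Mapping.keys (klein_embed (f (?e m 1)))"
        unfolding fe[OF g m] using x by (simp add: in_keys_iff)
      then show ?thesis using keys_klein_embed[OF fc[OF of_klein_closed]] by blast
    qed
    then show "x \<in> klein_monoid" using sat[OF g] by blast
  qed
  define F where "F = (\<lambda>g\<in>carrier G. of_klein (Q g))"
  have F: "F \<in> carrier (smash_product G ?A ?gr)"
    by (auto simp: F_def smash_product_def of_klein_closed)
  have embed_F: "klein_embed (F g) = Q g" if "g \<in> carrier G" for g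
    using that by (simp add: F_def klein_embed_of_klein Q_pos)
  have "auslander_map G ?A ?gr F = f"
  proof (rule U.auslander_map_eqI[OF F f])
    fix g y assume g: "g \<in> carrier G" and y: "y \<in> ?gr g"
    have yc: "y \<in> carrier ?A" using U.gr_carrier g y by blast
    have Fg: "F g \<in> carrier ?A" using U.smash_carrier_closed F g .
    let ?S = "\<lambda>S. \<Sum>n\<in>S. Poly_Mapping.single n (Poly_Mapping.lookup (klein_embed y) n)"
    have "f (of_klein (?S S)) = F g \<otimes>\<^bsub>?A\<^esub> of_klein (?S S)"
      if "finite S" "S \<subseteq> Poly_Mapping.keys (klein_embed y)" for S
      using that
    proof (induction S rule: finite_induct)
      case empty
      have z: "of_klein 0 = \<zero>\<^bsub>?A\<^esub>" by (simp add: of_klein_def uv_algebra_simps)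
      have "f \<zero>\<^bsub>?A\<^esub> = \<zero>\<^bsub>?A\<^esub>" using fadd[of "\<zero>\<^bsub>?A\<^esub>" "\<zero>\<^bsub>?A\<^esub>"] fc[of "\<zero>\<^bsub>?A\<^esub>"] by simp
      then show ?case using Fg by (simp add: z)
    next
      case (insert n S)
      let ?c = "Poly_Mapping.lookup (klein_embed y) n"
      have n: "n \<in> klein_monoid" "klein_degree n = g"
        using insert.prems keys_klein_embed[OF yc] y by (auto simp: uv_grading_iff)
      have "klein_embed (f (?e n ?c)) = klein_embed (F g \<otimes>\<^bsub>?A\<^esub> ?e n ?c)"
        using Fg by (simp add: fe[OF g n] klein_embed_mult of_klein_closed embed_F[OF g] klein_embed_single[OF n(1)])
      then have "f (?e n ?c) = F g \<otimes>\<^bsub>?A\<^esub> ?e n ?c"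
        using klein_embed_inj[OF fc[OF of_klein_closed] U.A.m_closed[OF Fg of_klein_closed]] by simp
      then show ?case
        using insert Fg by (simp add: of_klein_add fadd of_klein_closed U.A.r_distr)
    qed
    from this[OF finite_keys subset_refl]
    have "f (of_klein (klein_embed y)) = F g \<otimes>\<^bsub>?A\<^esub> of_klein (klein_embed y)"
      using push_forward_cong_id[of "klein_embed y" "\<lambda>n. n"] by (simp add: push_forward_def)
    then show "f y = F g \<otimes>\<^bsub>?A\<^esub> y" by (simp add: of_klein_klein_embed[OF yc])
  qed
  then show ?thesis using F by blast
qed

lemma auslander_map_iso_iff:
  assumes "\<not> comm_group G"
  shows "auslander_map G (uv_algebra :: ('k::field, (uv, 'k) free_alg_elem set) module) (uv_grading G a b)
      \<in> ring_iso (smash_product G uv_algebra (uv_grading G a b))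
          (right_End uv_algebra (inv_ring G uv_algebra (uv_grading G a b)))
    \<longleftrightarrow> Coset.order G = 2 * ord (a \<otimes> b)"
proof -
  let ?gr = "uv_grading G a b :: 'g \<Rightarrow> (uv, 'k) free_alg_elem set set"
  let ?A = "uv_algebra :: ('k::field, (uv, 'k) free_alg_elem set) module"
  interpret U: graded_algebra G ?A ?gr by (rule graded_algebra_uv_algebra)
  have "auslander_map G ?A ?gr ` carrier (smash_product G ?A ?gr) \<subseteq> carrier (right_End ?A (inv_ring G ?A ?gr))"
    by (rule image_subsetI) (rule U.auslander_map_mem)
  then have "auslander_map G ?A ?gr \<in> ring_iso (smash_product G ?A ?gr) (right_End ?A (inv_ring G ?A ?gr))
      \<longleftrightarrow> carrier (right_End ?A (inv_ring G ?A ?gr)) \<subseteq> auslander_map G ?A ?gr ` carrier (smash_product G ?A ?gr)"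
    using U.auslander_map_ring_hom auslander_map_inj
    unfolding ring_iso_def bij_betw_def mem_Collect_eq by (metis subset_antisym subset_refl)
  also have "\<dots> \<longleftrightarrow> (\<forall>g\<in>carrier G. \<forall>x. (\<forall>m\<in>klein_monoid. klein_degree m = g \<longrightarrow> x + m \<in> klein_monoid) \<longrightarrow> x \<in> klein_monoid)"
    (is "?surj \<longleftrightarrow> ?sat")
  proof
    assume ?surj
    show ?sat
      by (intro ballI allI impI, rule saturated_if_auslander_map_surj[OF \<open>?surj\<close>]) auto
  next
    assume sat: ?sat
    show ?surj
    proof
      fix f assume f: "f \<in> carrier (right_End ?A (inv_ring G ?A ?gr))"
      have "\<exists>F\<in>carrier (smash_product G ?A ?gr). auslander_map G ?A ?gr F = f"
        by (rule auslander_map_surj_if_saturated[OF f]) (use sat in blast)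
      then show "f \<in> auslander_map G ?A ?gr ` carrier (smash_product G ?A ?gr)" by blast
    qed
  qed
  also have "\<dots> \<longleftrightarrow> Coset.order G = 2 * ord (a \<otimes> b)" by (rule saturated_iff[OF assms])
  finally show ?thesis .
qed

end

theorem theorem1p2:
  fixes G :: "('g, 'm) monoid_scheme" (structure)
    and a b :: 'g
  assumes "group G" and "finite (carrier G)" and "\<not> comm_group G"
    and "a \<in> carrier G" and "b \<in> carrier G"
    and "generate G {a, b} = carrier G"
    and "a \<otimes> a = b \<otimes> b"
  shows "auslander_map G
           (uv_algebra :: ('k :: {alg_closed_field, field_char_0}, (uv, 'k) free_alg_elem set) module)
           (uv_grading G a b)
         \<in> ring_iso (smash_product G uv_algebra (uv_grading G a b))
                    (right_End uv_algebra (inv_ring G uv_algebra (uv_grading G a b)))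
         \<longleftrightarrow> real (group.ord G (a \<otimes> b)) = 1 / 2 * real (Coset.order G)"
proof -
  interpret equal_squares G a b
    by (intro equal_squares.intro equal_squares_axioms.intro assms)
  have "real (ord (a \<otimes> b)) = 1 / 2 * real (Coset.order G) \<longleftrightarrow> Coset.order G = 2 * ord (a \<otimes> b)"
    by linarith
  then show ?thesis using auslander_map_iso_iff[OF assms(3)] by simp
qed

end
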